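(* Let $\kappa$ be an infinite cardinal and $S$ a cardinal with $0<S<\kappa$. Then $(C,d)\mapsto C_d$ induces a one-to-one correspondence between isomorphism classes of single-sorted $<\kappa$-ary clones with $S$-ary diagonal operations and isomorphism classes of $S$-sorted $<\kappa$-ary pure clones; the inverse correspondence is given by $M\mapsto(\mathrm{H}(M),(\pi_{(S\times S,p_2,(s,s))})_{s\in S})$.
   Context: Cardinals are identified with the sets of smaller ordinals. An $S$-sorted $<\kappa$-ary clone $M$ consists of: for every cardinal $\lambda<\kappa$, map $v:\lambda\to S$ and $s\in S$ a set $M_{(\lambda,v,s)}$; projections $\pi_{(\lambda,v,i)}\in M_{(\lambda,v,v(i))}$; composition maps $M_{(\lambda_1,v_1,s)}\times\prod_{i\in\lambda_1}M_{(\lambda_2,v_2,v_1(i))}\to M_{(\lambda_2,v_2,s)}$, $(f,(g_i)_i)\mapsto f\circ(g_i)_i$, which is associative and satisfies $\pi_{(\lambda_1,v_1,i_0)}\circ(g_i)_i=g_{i_0}$, $f\circ(\pi_{(\lambda,v,i)})_i=f$. Sets of size $<\kappa$ may serve as arities via fixed bijections. Isomorphisms of clones are sortwise bijections preserving projections and composition. A single-sorted clone is the case $S=1$, sorts written $\lambda$, projections $\pi_{(\lambda,i)}$. $M$ is pure if $M_{(1,v,s_2)}\neq\emptyset$ whenever $v(0)=s_1$, for all $s_1,s_2\in S$. The homogenization $\mathrm{H}(M)$ is the single-sorted clone with $\mathrm{H}_\lambda(M)=\prod_{s\in S}M_{(\lambda\times S,p_2,s)}$ ($p_2$ the second projection $\lambda\times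 S\to S$), projections $(\pi_{(\lambda\times S,p_2,(i,s))})_{s\in S}$, composition $(f_s)_s\circ((g_{i,t})_t)_{i}=(f_s\circ(g_{i,t})_{(i,t)\in\lambda_1\times S})_s$. For a single-sorted clone $C$, an $S$-ary diagonal pair is $(d,(e_s)_{s\in S})$ with $d\in C_S$, $e_s\in C_1$ such that (1) $e_s\circ d=e_s\circ\pi_{(S,s)}$ for all $s$; (2) $d\circ(e_s\circ\pi_{(S,s)})_{s\in S}=d$; (3) $d\circ(\pi_{(S,0)})_{s\in S}=\pi_{(S,0)}$. A clone with an $S$-ary diagonal operation is a pair $(C,d)$, $d\in C_S$, such that some $(e_s)$ makes $(d,(e_s))$ a diagonal pair; $(C,d)\cong(C',d')$ if there is a clone isomorphism $C\to C'$ sending $d$ to $d'$. Given a diagonal pair, the heterogenization $C_{(d,(e_s))}$ is the $S$-sorted clone with $C_{(d,(e_s)),(\lambda,v,t)}=\{f\in C_\lambda: e_t\circ f=f\}/\sim_{\lambda,v}$, where $f\sim_{\lambda,v}g$ iff $f\circ(e_{v(i)}\circ\pi_{(\lambda,i)})_{i\in\lambda}=g\circ(e_{v(i)}\circ\pi_{(\lambda,i)})_{i\in\lambda}$, projections $e_{v(i)}\circ\pi_{(\lambda,i)}/\sim$ and composition $(f/\sim,(g_i/\sim)_i)\mapsto(f\circ(g_i)_i)/\sim$. $C_d$ denotes $C_{(d,(e_s))}$ for any $(e_s)$ such that $(d,(e_s))$ is a diagonal pair. *)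

theory Defs
  imports "HOL-Library.FuncSet"
begin

section \<open>Cardinals below an infinite cardinal\<close>

text \<open>
  The cardinal \<open>\<kappa>\<close> is a cardinal order in the sense of the library. Elements \<open>l\<close> of its field
  are the ordinals below \<open>\<kappa>\<close>, and \<open>l\<close> is identified with the set \<open>underS \<kappa> l\<close> of smaller
  ordinals. The following set consists of the cardinals \<open>l < \<kappa>\<close>.
\<close>

definition cardinals :: "'k rel \<Rightarrow> 'k set" where
  "cardinals \<kappa> = {l \<in> Field \<kappa>. Card_order (Restr \<kappa> (underS \<kappa> l))}"

definition ord0 :: "'k rel \<Rightarrow> 'k" where
  "ord0 \<kappa> = (THE z. z \<in> Field \<kappa> \<and> underS \<kappa> z = {})"

definition ord1 :: "'k rel \<Rightarrow> 'k" where
  "ord1 \<kappa> = (THE z. z \<in> Field \<kappa> \<and> underS \<kappa> z = {ord0 \<kappa>})"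


section \<open>Many-sorted clones\<close>

text \<open>
  \<open>cl_ops M l v s\<close> is \<open>M\<^bsub>(l,v,s)\<^esub>\<close>, \<open>cl_proj M l v i\<close> is \<open>\<pi>\<^bsub>(l,v,i)\<^esub>\<close>, and
  \<open>cl_comp M l1 v1 l2 v2 s f g\<close> is \<open>f \<circ> (g i)\<^sub>i\<close> for \<open>f\<close> in \<open>M\<^bsub>(l1,v1,s)\<^esub>\<close> and
  \<open>g i\<close> in \<open>M\<^bsub>(l2,v2,v1 i)\<^esub>\<close>. Maps and families are extensional functions; values of the
  record components at other arguments are never used.
\<close>

record ('k, 'a) clone =
  cl_ops :: "'k \<Rightarrow> ('k \<Rightarrow> 'k) \<Rightarrow> 'k \<Rightarrow> 'a set"
  cl_proj :: "'k \<Rightarrow> ('k \<Rightarrow> 'k) \<Rightarrow> 'k \<Rightarrow> 'a"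
  cl_comp :: "'k \<Rightarrow> ('k \<Rightarrow> 'k) \<Rightarrow> 'k \<Rightarrow> ('k \<Rightarrow> 'k) \<Rightarrow> 'k \<Rightarrow> 'a \<Rightarrow> ('k \<Rightarrow> 'a) \<Rightarrow> 'a"

abbreviation sortings :: "'k rel \<Rightarrow> 'k \<Rightarrow> 'k \<Rightarrow> ('k \<Rightarrow> 'k) set" where
  "sortings \<kappa> S l \<equiv> underS \<kappa> l \<rightarrow>\<^sub>E underS \<kappa> S"

abbreviation families ::
  "'k rel \<Rightarrow> ('k, 'a) clone \<Rightarrow> 'k \<Rightarrow> ('k \<Rightarrow> 'k) \<Rightarrow> 'k \<Rightarrow> ('k \<Rightarrow> 'k) \<Rightarrow> ('k \<Rightarrow> 'a) set" where
  "families \<kappa> M l1 v1 l2 v2 \<equiv> (\<Pi>\<^sub>E i\<in>underS \<kappa> l1. cl_ops M l2 v2 (v1 i))"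

definition is_clone :: "'k rel \<Rightarrow> 'k \<Rightarrow> ('k, 'a) clone \<Rightarrow> bool" where
  "is_clone \<kappa> S M \<longleftrightarrow>
     (\<forall>l\<in>cardinals \<kappa>. \<forall>v\<in>sortings \<kappa> S l. \<forall>i\<in>underS \<kappa> l.
        cl_proj M l v i \<in> cl_ops M l v (v i)) \<and>
     (\<forall>l1\<in>cardinals \<kappa>. \<forall>l2\<in>cardinals \<kappa>.
      \<forall>v1\<in>sortings \<kappa> S l1. \<forall>v2\<in>sortings \<kappa> S l2. \<forall>s\<in>underS \<kappa> S.
      \<forall>f\<in>cl_ops M l1 v1 s. \<forall>g\<in>families \<kappa> M l1 v1 l2 v2.
        cl_comp M l1 v1 l2 v2 s f g \<in> cl_ops M l2 v2 s) \<and>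
     (\<forall>l1\<in>cardinals \<kappa>. \<forall>l2\<in>cardinals \<kappa>. \<forall>l3\<in>cardinals \<kappa>.
      \<forall>v1\<in>sortings \<kappa> S l1. \<forall>v2\<in>sortings \<kappa> S l2. \<forall>v3\<in>sortings \<kappa> S l3. \<forall>s\<in>underS \<kappa> S.
      \<forall>f\<in>cl_ops M l1 v1 s. \<forall>g\<in>families \<kappa> M l1 v1 l2 v2. \<forall>h\<in>families \<kappa> M l2 v2 l3 v3.
        cl_comp M l2 v2 l3 v3 s (cl_comp M l1 v1 l2 v2 s f g) h =
        cl_comp M l1 v1 l3 v3 s f
          (\<lambda>i\<in>underS \<kappa> l1. cl_comp M l2 v2 l3 v3 (v1 i) (g i) h)) \<and>
     (\<forall>l1\<in>cardinals \<kappa>. \<forall>l2\<in>cardinals \<kappa>.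
      \<forall>v1\<in>sortings \<kappa> S l1. \<forall>v2\<in>sortings \<kappa> S l2. \<forall>j\<in>underS \<kappa> l1.
      \<forall>g\<in>families \<kappa> M l1 v1 l2 v2.
        cl_comp M l1 v1 l2 v2 (v1 j) (cl_proj M l1 v1 j) g = g j) \<and>
     (\<forall>l\<in>cardinals \<kappa>. \<forall>v\<in>sortings \<kappa> S l. \<forall>s\<in>underS \<kappa> S. \<forall>f\<in>cl_ops M l v s.
        cl_comp M l v l v s f (\<lambda>i\<in>underS \<kappa> l. cl_proj M l v i) = f)"

definition clone_iso ::
  "'k rel \<Rightarrow> 'k \<Rightarrow> ('k, 'a) clone \<Rightarrow> ('k, 'b) clone \<Rightarrow>
   ('k \<Rightarrow> ('k \<Rightarrow> 'k) \<Rightarrow> 'k \<Rightarrow> 'a \<Rightarrow> 'b) \<Rightarrow> bool" where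
  "clone_iso \<kappa> S M N \<phi> \<longleftrightarrow>
     (\<forall>l\<in>cardinals \<kappa>. \<forall>v\<in>sortings \<kappa> S l. \<forall>s\<in>underS \<kappa> S.
        bij_betw (\<phi> l v s) (cl_ops M l v s) (cl_ops N l v s)) \<and>
     (\<forall>l\<in>cardinals \<kappa>. \<forall>v\<in>sortings \<kappa> S l. \<forall>i\<in>underS \<kappa> l.
        \<phi> l v (v i) (cl_proj M l v i) = cl_proj N l v i) \<and>
     (\<forall>l1\<in>cardinals \<kappa>. \<forall>l2\<in>cardinals \<kappa>.
      \<forall>v1\<in>sortings \<kappa> S l1. \<forall>v2\<in>sortings \<kappa> S l2. \<forall>s\<in>underS \<kappa> S.
      \<forall>f\<in>cl_ops M l1 v1 s. \<forall>g\<in>families \<kappa> M l1 v1 l2 v2.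
        \<phi> l2 v2 s (cl_comp M l1 v1 l2 v2 s f g) =
        cl_comp N l1 v1 l2 v2 s (\<phi> l1 v1 s f) (\<lambda>i\<in>underS \<kappa> l1. \<phi> l2 v2 (v1 i) (g i)))"

definition clone_isomorphic ::
  "'k rel \<Rightarrow> 'k \<Rightarrow> ('k, 'a) clone \<Rightarrow> ('k, 'b) clone \<Rightarrow> bool" where
  "clone_isomorphic \<kappa> S M N \<longleftrightarrow> (\<exists>\<phi>. clone_iso \<kappa> S M N \<phi>)"

definition pure_clone :: "'k rel \<Rightarrow> 'k \<Rightarrow> ('k, 'a) clone \<Rightarrow> bool" where
  "pure_clone \<kappa> S M \<longleftrightarrow> is_clone \<kappa> S M \<and>
     (\<forall>s1\<in>underS \<kappa> S. \<forall>s2\<in>underS \<kappa> S.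
        cl_ops M (ord1 \<kappa>) (\<lambda>i\<in>underS \<kappa> (ord1 \<kappa>). s1) s2 \<noteq> {})"


section \<open>Arbitrary sets of size less than \<open>\<kappa>\<close> as arities\<close>

definition arity_card :: "'k rel \<Rightarrow> 'i set \<Rightarrow> 'k" where
  "arity_card \<kappa> A = (THE l. l \<in> cardinals \<kappa> \<and> (\<exists>b. bij_betw b (underS \<kappa> l) A))"

definition arity_bij :: "'k rel \<Rightarrow> 'i set \<Rightarrow> 'k \<Rightarrow> 'i" where
  "arity_bij \<kappa> A = (SOME b. bij_betw b (underS \<kappa> (arity_card \<kappa> A)) A)"

definition arity_map :: "'k rel \<Rightarrow> 'i set \<Rightarrow> ('i \<Rightarrow> 'x) \<Rightarrow> 'k \<Rightarrow> 'x" where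
  "arity_map \<kappa> A v = (\<lambda>j\<in>underS \<kappa> (arity_card \<kappa> A). v (arity_bij \<kappa> A j))"

definition set_ops ::
  "'k rel \<Rightarrow> ('k, 'a) clone \<Rightarrow> 'i set \<Rightarrow> ('i \<Rightarrow> 'k) \<Rightarrow> 'k \<Rightarrow> 'a set" where
  "set_ops \<kappa> M A v s = cl_ops M (arity_card \<kappa> A) (arity_map \<kappa> A v) s"

definition set_proj ::
  "'k rel \<Rightarrow> ('k, 'a) clone \<Rightarrow> 'i set \<Rightarrow> ('i \<Rightarrow> 'k) \<Rightarrow> 'i \<Rightarrow> 'a" where
  "set_proj \<kappa> M A v a = cl_proj M (arity_card \<kappa> A) (arity_map \<kappa> A v)
     (the_inv_into (underS \<kappa> (arity_card \<kappa> A)) (arity_bij \<kappa> A) a)"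

definition set_comp ::
  "'k rel \<Rightarrow> ('k, 'a) clone \<Rightarrow> 'i set \<Rightarrow> ('i \<Rightarrow> 'k) \<Rightarrow> 'j set \<Rightarrow> ('j \<Rightarrow> 'k) \<Rightarrow> 'k \<Rightarrow>
   'a \<Rightarrow> ('i \<Rightarrow> 'a) \<Rightarrow> 'a" where
  "set_comp \<kappa> M A v B w s f g =
     cl_comp M (arity_card \<kappa> A) (arity_map \<kappa> A v) (arity_card \<kappa> B) (arity_map \<kappa> B w) s
       f (arity_map \<kappa> A g)"


section \<open>Single-sorted clones and diagonal pairs\<close>

text \<open>
  A single-sorted clone is a clone whose cardinal of sorts is \<open>1 = {0}\<close>; the only sort is \<open>0\<close>
  and the only map \<open>l \<rightarrow> 1\<close> is constant.
\<close>

abbreviation single_sorted :: "'k rel \<Rightarrow> ('k, 'a) clone \<Rightarrow> bool" where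
  "single_sorted \<kappa> C \<equiv> is_clone \<kappa> (ord1 \<kappa>) C"

definition const_sort :: "'k rel \<Rightarrow> 'k \<Rightarrow> 'k \<Rightarrow> 'k" where
  "const_sort \<kappa> l = (\<lambda>i\<in>underS \<kappa> l. ord0 \<kappa>)"

definition ss_ops :: "'k rel \<Rightarrow> ('k, 'a) clone \<Rightarrow> 'k \<Rightarrow> 'a set" where
  "ss_ops \<kappa> C l = cl_ops C l (const_sort \<kappa> l) (ord0 \<kappa>)"

definition ss_proj :: "'k rel \<Rightarrow> ('k, 'a) clone \<Rightarrow> 'k \<Rightarrow> 'k \<Rightarrow> 'a" where
  "ss_proj \<kappa> C l i = cl_proj C l (const_sort \<kappa> l) i"

definition ss_comp ::
  "'k rel \<Rightarrow> ('k, 'a) clone \<Rightarrow> 'k \<Rightarrow> 'k \<Rightarrow> 'a \<Rightarrow> ('k \<Rightarrow> 'a) \<Rightarrow> 'a" where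
  "ss_comp \<kappa> C l1 l2 f g =
     cl_comp C l1 (const_sort \<kappa> l1) l2 (const_sort \<kappa> l2) (ord0 \<kappa>) f g"

text \<open>\<open>ss_unary \<kappa> C l e f\<close> is \<open>e \<circ> f\<close> for \<open>e\<close> in \<open>C\<^sub>1\<close> and \<open>f\<close> in \<open>C\<^sub>l\<close>.\<close>

definition ss_unary :: "'k rel \<Rightarrow> ('k, 'a) clone \<Rightarrow> 'k \<Rightarrow> 'a \<Rightarrow> 'a \<Rightarrow> 'a" where
  "ss_unary \<kappa> C l e f = ss_comp \<kappa> C (ord1 \<kappa>) l e (\<lambda>i\<in>underS \<kappa> (ord1 \<kappa>). f)"

definition diagonal_pair ::
  "'k rel \<Rightarrow> 'k \<Rightarrow> ('k, 'a) clone \<Rightarrow> 'a \<Rightarrow> ('k \<Rightarrow> 'a) \<Rightarrow> bool" where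
  "diagonal_pair \<kappa> S C d e \<longleftrightarrow>
     d \<in> ss_ops \<kappa> C S \<and>
     (\<forall>s\<in>underS \<kappa> S. e s \<in> ss_ops \<kappa> C (ord1 \<kappa>)) \<and>
     (\<forall>s\<in>underS \<kappa> S. ss_unary \<kappa> C S (e s) d = ss_unary \<kappa> C S (e s) (ss_proj \<kappa> C S s)) \<and>
     ss_comp \<kappa> C S S d (\<lambda>s\<in>underS \<kappa> S. ss_unary \<kappa> C S (e s) (ss_proj \<kappa> C S s)) = d \<and>
     ss_comp \<kappa> C S S d (\<lambda>s\<in>underS \<kappa> S. ss_proj \<kappa> C S (ord0 \<kappa>)) = ss_proj \<kappa> C S (ord0 \<kappa>)"

definition diagonal_clone :: "'k rel \<Rightarrow> 'k \<Rightarrow> ('k, 'a) clone \<times> 'a \<Rightarrow> bool" where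
  "diagonal_clone \<kappa> S = (\<lambda>(C, d). single_sorted \<kappa> C \<and> (\<exists>e. diagonal_pair \<kappa> S C d e))"

definition diagonal_isomorphic ::
  "'k rel \<Rightarrow> 'k \<Rightarrow> ('k, 'a) clone \<times> 'a \<Rightarrow> ('k, 'b) clone \<times> 'b \<Rightarrow> bool" where
  "diagonal_isomorphic \<kappa> S = (\<lambda>(C, d) (C', d').
     \<exists>\<phi>. clone_iso \<kappa> (ord1 \<kappa>) C C' \<phi> \<and> \<phi> S (const_sort \<kappa> S) (ord0 \<kappa>) d = d')"


section \<open>Homogenization\<close>

definition homogenization :: "'k rel \<Rightarrow> 'k \<Rightarrow> ('k, 'a) clone \<Rightarrow> ('k, 'k \<Rightarrow> 'a) clone" where
  "homogenization \<kappa> S M =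
     \<lparr>cl_ops = (\<lambda>l _ _. \<Pi>\<^sub>E s\<in>underS \<kappa> S. set_ops \<kappa> M (underS \<kappa> l \<times> underS \<kappa> S) snd s),
      cl_proj = (\<lambda>l _ i. \<lambda>s\<in>underS \<kappa> S. set_proj \<kappa> M (underS \<kappa> l \<times> underS \<kappa> S) snd (i, s)),
      cl_comp = (\<lambda>l1 _ l2 _ _ f g. \<lambda>s\<in>underS \<kappa> S.
        set_comp \<kappa> M (underS \<kappa> l1 \<times> underS \<kappa> S) snd (underS \<kappa> l2 \<times> underS \<kappa> S) snd s
          (f s) (\<lambda>(i, t). g i t))\<rparr>"

definition homogenization_diag :: "'k rel \<Rightarrow> 'k \<Rightarrow> ('k, 'a) clone \<Rightarrow> 'k \<Rightarrow> 'a" where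
  "homogenization_diag \<kappa> S M =
     (\<lambda>s\<in>underS \<kappa> S. set_proj \<kappa> M (underS \<kappa> S \<times> underS \<kappa> S) snd (s, s))"

definition diag_of_clone ::
  "'k rel \<Rightarrow> 'k \<Rightarrow> ('k, 'a) clone \<Rightarrow> ('k, 'k \<Rightarrow> 'a) clone \<times> ('k \<Rightarrow> 'a)" where
  "diag_of_clone \<kappa> S M = (homogenization \<kappa> S M, homogenization_diag \<kappa> S M)"


section \<open>Heterogenization\<close>

definition het_carrier ::
  "'k rel \<Rightarrow> ('k, 'a) clone \<Rightarrow> ('k \<Rightarrow> 'a) \<Rightarrow> 'k \<Rightarrow> 'k \<Rightarrow> 'a set" where
  "het_carrier \<kappa> C e l t = {f \<in> ss_ops \<kappa> C l. ss_unary \<kappa> C l (e t) f = f}"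

definition het_restrict ::
  "'k rel \<Rightarrow> ('k, 'a) clone \<Rightarrow> ('k \<Rightarrow> 'a) \<Rightarrow> 'k \<Rightarrow> ('k \<Rightarrow> 'k) \<Rightarrow> 'a \<Rightarrow> 'a" where
  "het_restrict \<kappa> C e l v f =
     ss_comp \<kappa> C l l f (\<lambda>i\<in>underS \<kappa> l. ss_unary \<kappa> C l (e (v i)) (ss_proj \<kappa> C l i))"

definition het_rel ::
  "'k rel \<Rightarrow> ('k, 'a) clone \<Rightarrow> ('k \<Rightarrow> 'a) \<Rightarrow> 'k \<Rightarrow> ('k \<Rightarrow> 'k) \<Rightarrow> 'k \<Rightarrow> 'a rel" where
  "het_rel \<kappa> C e l v t =
     {(f, g) \<in> het_carrier \<kappa> C e l t \<times> het_carrier \<kappa> C e l t.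
        het_restrict \<kappa> C e l v f = het_restrict \<kappa> C e l v g}"

text \<open>
  The composite of classes is the union of the classes of the composites of all choices of
  representatives; all these classes coincide when \<open>e\<close> is part of a diagonal pair.
\<close>

definition heterogenization ::
  "'k rel \<Rightarrow> ('k, 'a) clone \<Rightarrow> ('k \<Rightarrow> 'a) \<Rightarrow> ('k, 'a set) clone" where
  "heterogenization \<kappa> C e =
     \<lparr>cl_ops = (\<lambda>l v t. het_carrier \<kappa> C e l t // het_rel \<kappa> C e l v t),
      cl_proj = (\<lambda>l v i. het_rel \<kappa> C e l v (v i) `` {ss_unary \<kappa> C l (e (v i)) (ss_proj \<kappa> C l i)}),
      cl_comp = (\<lambda>l1 v1 l2 v2 t F G.
        \<Union>f\<in>F. \<Union>g\<in>(\<Pi>\<^sub>E i\<in>underS \<kappa> l1. G i). het_rel \<kappa> C e l2 v2 t `` {ss_comp \<kappa> C l1 l2 f g})\<rparr>"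

definition clone_of_diag :: "'k rel \<Rightarrow> 'k \<Rightarrow> ('k, 'a) clone \<times> 'a \<Rightarrow> ('k, 'a set) clone" where
  "clone_of_diag \<kappa> S = (\<lambda>(C, d). heterogenization \<kappa> C (SOME e. diagonal_pair \<kappa> S C d e))"


section \<open>Isomorphism classes\<close>

text \<open>
  Isomorphism classes are taken among the clones whose operations are elements of a fixed
  type \<open>'u\<close>. The induced maps send the class of \<open>(C, d)\<close> to the class of all \<open>'u\<close>-clones isomorphic
  to \<open>C\<^sub>d\<close> (whose operations are of type \<open>'u set\<close>), and analogously for homogenization.
\<close>

definition diagonal_classes :: "'k rel \<Rightarrow> 'k \<Rightarrow> (('k, 'u) clone \<times> 'u) set set" where
  "diagonal_classes \<kappa> S =
     {X. diagonal_clone \<kappa> S X} //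
     {(X, Y). diagonal_clone \<kappa> S X \<and> diagonal_clone \<kappa> S Y \<and> diagonal_isomorphic \<kappa> S X Y}"

definition pure_classes :: "'k rel \<Rightarrow> 'k \<Rightarrow> ('k, 'u) clone set set" where
  "pure_classes \<kappa> S =
     {M. pure_clone \<kappa> S M} //
     {(M, N). pure_clone \<kappa> S M \<and> pure_clone \<kappa> S N \<and> clone_isomorphic \<kappa> S M N}"

definition het_class ::
  "'k rel \<Rightarrow> 'k \<Rightarrow> (('k, 'u) clone \<times> 'u) set \<Rightarrow> ('k, 'u) clone set" where
  "het_class \<kappa> S \<X> = {N. pure_clone \<kappa> S N \<and> (\<exists>X\<in>\<X>. clone_isomorphic \<kappa> S (clone_of_diag \<kappa> S X) N)}"

definition hom_class ::
  "'k rel \<Rightarrow> 'k \<Rightarrow> ('k, 'u) clone set \<Rightarrow> (('k, 'u) clone \<times> 'u) set" where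
  "hom_class \<kappa> S \<M> = {Y. diagonal_clone \<kappa> S Y \<and> (\<exists>M\<in>\<M>. diagonal_isomorphic \<kappa> S (diag_of_clone \<kappa> S M) Y)}"

end

theory Submission
  imports Defs
begin

text \<open>
  Put \<open>d\<close> and \<open>e\<^sub>s\<close> in a diagonal pair. The unary operations \<open>e\<^sub>s\<close> are idempotent, and every class
  of \<open>C\<^sub>d\<close> contains exactly one \<open>f\<close> with \<open>e\<^sub>t \<circ> f = f = f \<circ> (e\<^bsub>v(i)\<^esub> \<circ> \<pi>\<^sub>i)\<^sub>i\<close>. These representatives
  are closed under the composition of \<open>C\<close>, so \<open>C\<^sub>d\<close> is isomorphic to a clone \<open>R\<close> without quotients.

  The map \<open>f \<mapsto> (e\<^sub>s \<circ> f \<circ> (d \<circ> (\<pi>\<^bsub>(i,t)\<^esub>)\<^sub>t)\<^sub>i)\<^sub>s\<close> is an isomorphism from \<open>(C, d)\<close> to \<open>H(R)\<close> with its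
  diagonal; its inverse is \<open>(f\<^sub>s)\<^sub>s \<mapsto> d \<circ> (f\<^sub>s \<circ> (\<pi>\<^sub>i)\<^bsub>(i,t)\<^esub>)\<^sub>s\<close>. Conversely, purity of \<open>M\<close> provides
  unary operations \<open>c\<^bsub>s,t\<^esub>\<close> from sort \<open>s\<close> to sort \<open>t\<close> with \<open>c\<^bsub>s,s\<^esub> = \<pi>\<close>, the operations
  \<open>e\<^sub>s = (c\<^bsub>s,t\<^esub> \<circ> \<pi>\<^bsub>(0,s)\<^esub>)\<^sub>t\<close> complete the diagonal of \<open>H(M)\<close> to a diagonal pair, and
  \<open>g \<mapsto> (c\<^bsub>t,s\<^esub> \<circ> g \<circ> (\<pi>\<^bsub>(i,v(i))\<^esub>)\<^sub>i)\<^sub>s\<close> is an isomorphism from \<open>M\<close> to the clone \<open>R\<close> of \<open>H(M)\<close>.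
\<close>

section \<open>Isomorphisms of clones\<close>

lemma clone_proj_mem:
  assumes "is_clone \<kappa> S M" "l \<in> cardinals \<kappa>" "v \<in> sortings \<kappa> S l" "i \<in> underS \<kappa> l" "v i = s"
  shows "cl_proj M l v i \<in> cl_ops M l v s"
  using assms(1)[unfolded is_clone_def, THEN conjunct1, rule_format, OF assms(2-4)] assms(5) by simp

lemma clone_comp_mem:
  assumes "is_clone \<kappa> S M" "l1 \<in> cardinals \<kappa>" "l2 \<in> cardinals \<kappa>"
    "v1 \<in> sortings \<kappa> S l1" "v2 \<in> sortings \<kappa> S l2" "s \<in> underS \<kappa> S"
    "f \<in> cl_ops M l1 v1 s" "g \<in> families \<kappa> M l1 v1 l2 v2"
  shows "cl_comp M l1 v1 l2 v2 s f g \<in> cl_ops M l2 v2 s"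
  using assms(1)[unfolded is_clone_def, THEN conjunct2, THEN conjunct1, rule_format, OF assms(2-8)] .

lemma clone_comp_assoc:
  assumes "is_clone \<kappa> S M" "l1 \<in> cardinals \<kappa>" "l2 \<in> cardinals \<kappa>" "l3 \<in> cardinals \<kappa>"
    "v1 \<in> sortings \<kappa> S l1" "v2 \<in> sortings \<kappa> S l2" "v3 \<in> sortings \<kappa> S l3" "s \<in> underS \<kappa> S"
    "f \<in> cl_ops M l1 v1 s" "g \<in> families \<kappa> M l1 v1 l2 v2" "h \<in> families \<kappa> M l2 v2 l3 v3"
  shows "cl_comp M l2 v2 l3 v3 s (cl_comp M l1 v1 l2 v2 s f g) h =
    cl_comp M l1 v1 l3 v3 s f (\<lambda>i\<in>underS \<kappa> l1. cl_comp M l2 v2 l3 v3 (v1 i) (g i) h)"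
  using assms unfolding is_clone_def by blast

lemma clone_comp_families:
  assumes "is_clone \<kappa> S M" "l1 \<in> cardinals \<kappa>" "l2 \<in> cardinals \<kappa>" "l3 \<in> cardinals \<kappa>"
    "v1 \<in> sortings \<kappa> S l1" "v2 \<in> sortings \<kappa> S l2" "v3 \<in> sortings \<kappa> S l3"
    "g \<in> families \<kappa> M l1 v1 l2 v2" "h \<in> families \<kappa> M l2 v2 l3 v3"
  shows "(\<lambda>i\<in>underS \<kappa> l1. cl_comp M l2 v2 l3 v3 (v1 i) (g i) h) \<in> families \<kappa> M l1 v1 l3 v3"
  using assms(2-) PiE_mem[OF assms(5)] PiE_mem[OF assms(8)]
  by (simp add: clone_comp_mem[OF assms(1)])

lemma clone_proj_comp:
  assumes "is_clone \<kappa> S M" "l1 \<in> cardinals \<kappa>" "l2 \<in> cardinals \<kappa>"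
    "v1 \<in> sortings \<kappa> S l1" "v2 \<in> sortings \<kappa> S l2" "j \<in> underS \<kappa> l1" "v1 j = s"
    "g \<in> families \<kappa> M l1 v1 l2 v2"
  shows "cl_comp M l1 v1 l2 v2 s (cl_proj M l1 v1 j) g = g j"
  using assms(1-6,8) unfolding assms(7)[symmetric] is_clone_def by blast

lemma clone_comp_proj:
  assumes "is_clone \<kappa> S M" "l \<in> cardinals \<kappa>" "v \<in> sortings \<kappa> S l" "s \<in> underS \<kappa> S"
    "f \<in> cl_ops M l v s"
  shows "cl_comp M l v l v s f (\<lambda>i\<in>underS \<kappa> l. cl_proj M l v i) = f"
  using assms unfolding is_clone_def by blast

lemma is_cloneI:
  assumes "\<And>l v i. l \<in> cardinals \<kappa> \<Longrightarrow> v \<in> sortings \<kappa> S l \<Longrightarrow> i \<in> underS \<kappa> l \<Longrightarrow>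
      cl_proj M l v i \<in> cl_ops M l v (v i)"
    and "\<And>l1 l2 v1 v2 s f g. l1 \<in> cardinals \<kappa> \<Longrightarrow> l2 \<in> cardinals \<kappa> \<Longrightarrow>
      v1 \<in> sortings \<kappa> S l1 \<Longrightarrow> v2 \<in> sortings \<kappa> S l2 \<Longrightarrow> s \<in> underS \<kappa> S \<Longrightarrow>
      f \<in> cl_ops M l1 v1 s \<Longrightarrow> g \<in> families \<kappa> M l1 v1 l2 v2 \<Longrightarrow>
      cl_comp M l1 v1 l2 v2 s f g \<in> cl_ops M l2 v2 s"
    and "\<And>l1 l2 l3 v1 v2 v3 s f g h. l1 \<in> cardinals \<kappa> \<Longrightarrow> l2 \<in> cardinals \<kappa> \<Longrightarrow>
      l3 \<in> cardinals \<kappa> \<Longrightarrow> v1 \<in> sortings \<kappa> S l1 \<Longrightarrow> v2 \<in> sortings \<kappa> S l2 \<Longrightarrow>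
      v3 \<in> sortings \<kappa> S l3 \<Longrightarrow> s \<in> underS \<kappa> S \<Longrightarrow> f \<in> cl_ops M l1 v1 s \<Longrightarrow>
      g \<in> families \<kappa> M l1 v1 l2 v2 \<Longrightarrow> h \<in> families \<kappa> M l2 v2 l3 v3 \<Longrightarrow>
      cl_comp M l2 v2 l3 v3 s (cl_comp M l1 v1 l2 v2 s f g) h =
      cl_comp M l1 v1 l3 v3 s f (\<lambda>i\<in>underS \<kappa> l1. cl_comp M l2 v2 l3 v3 (v1 i) (g i) h)"
    and "\<And>l1 l2 v1 v2 j g. l1 \<in> cardinals \<kappa> \<Longrightarrow> l2 \<in> cardinals \<kappa> \<Longrightarrow>
      v1 \<in> sortings \<kappa> S l1 \<Longrightarrow> v2 \<in> sortings \<kappa> S l2 \<Longrightarrow> j \<in> underS \<kappa> l1 \<Longrightarrow>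
      g \<in> families \<kappa> M l1 v1 l2 v2 \<Longrightarrow>
      cl_comp M l1 v1 l2 v2 (v1 j) (cl_proj M l1 v1 j) g = g j"
    and "\<And>l v s f. l \<in> cardinals \<kappa> \<Longrightarrow> v \<in> sortings \<kappa> S l \<Longrightarrow> s \<in> underS \<kappa> S \<Longrightarrow>
      f \<in> cl_ops M l v s \<Longrightarrow>
      cl_comp M l v l v s f (\<lambda>i\<in>underS \<kappa> l. cl_proj M l v i) = f"
  shows "is_clone \<kappa> S M"
  unfolding is_clone_def by (intro conjI ballI; rule assms; assumption)

lemma clone_isoI:
  assumes "\<And>l v s. l \<in> cardinals \<kappa> \<Longrightarrow> v \<in> sortings \<kappa> S l \<Longrightarrow> s \<in> underS \<kappa> S \<Longrightarrow>
      bij_betw (\<phi> l v s) (cl_ops M l v s) (cl_ops N l v s)"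
    and "\<And>l v i. l \<in> cardinals \<kappa> \<Longrightarrow> v \<in> sortings \<kappa> S l \<Longrightarrow> i \<in> underS \<kappa> l \<Longrightarrow>
      \<phi> l v (v i) (cl_proj M l v i) = cl_proj N l v i"
    and "\<And>l1 l2 v1 v2 s f g. l1 \<in> cardinals \<kappa> \<Longrightarrow> l2 \<in> cardinals \<kappa> \<Longrightarrow>
      v1 \<in> sortings \<kappa> S l1 \<Longrightarrow> v2 \<in> sortings \<kappa> S l2 \<Longrightarrow> s \<in> underS \<kappa> S \<Longrightarrow>
      f \<in> cl_ops M l1 v1 s \<Longrightarrow> g \<in> families \<kappa> M l1 v1 l2 v2 \<Longrightarrow>
      \<phi> l2 v2 s (cl_comp M l1 v1 l2 v2 s f g) =
      cl_comp N l1 v1 l2 v2 s (\<phi> l1 v1 s f) (\<lambda>i\<in>underS \<kappa> l1. \<phi> l2 v2 (v1 i) (g i))"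
  shows "clone_iso \<kappa> S M N \<phi>"
  unfolding clone_iso_def by (intro conjI ballI; rule assms; assumption)

lemma clone_iso_bij:
  assumes "clone_iso \<kappa> S M N \<phi>" "l \<in> cardinals \<kappa>" "v \<in> sortings \<kappa> S l" "s \<in> underS \<kappa> S"
  shows "bij_betw (\<phi> l v s) (cl_ops M l v s) (cl_ops N l v s)"
  using assms unfolding clone_iso_def by blast

lemma clone_iso_mem:
  assumes "clone_iso \<kappa> S M N \<phi>" "l \<in> cardinals \<kappa>" "v \<in> sortings \<kappa> S l" "s \<in> underS \<kappa> S"
    "f \<in> cl_ops M l v s"
  shows "\<phi> l v s f \<in> cl_ops N l v s"
  using clone_iso_bij[OF assms(1-4)] assms(5) by (rule bij_betw_apply)

lemma clone_iso_proj:
  assumes "clone_iso \<kappa> S M N \<phi>" "l \<in> cardinals \<kappa>" "v \<in> sortings \<kappa> S l" "i \<in> underS \<kappa> l"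
    "v i = s"
  shows "\<phi> l v s (cl_proj M l v i) = cl_proj N l v i"
  using assms(1-4) unfolding assms(5)[symmetric] clone_iso_def by blast

lemma clone_iso_comp:
  assumes "clone_iso \<kappa> S M N \<phi>" "l1 \<in> cardinals \<kappa>" "l2 \<in> cardinals \<kappa>"
    "v1 \<in> sortings \<kappa> S l1" "v2 \<in> sortings \<kappa> S l2" "s \<in> underS \<kappa> S"
    "f \<in> cl_ops M l1 v1 s" "g \<in> families \<kappa> M l1 v1 l2 v2"
  shows "\<phi> l2 v2 s (cl_comp M l1 v1 l2 v2 s f g) =
    cl_comp N l1 v1 l2 v2 s (\<phi> l1 v1 s f) (\<lambda>i\<in>underS \<kappa> l1. \<phi> l2 v2 (v1 i) (g i))"
  using assms unfolding clone_iso_def by blast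

lemma sorting_mem: "v \<in> sortings \<kappa> S l \<Longrightarrow> i \<in> underS \<kappa> l \<Longrightarrow> v i \<in> underS \<kappa> S"
  by (rule PiE_mem)

lemma clone_iso_refl: "is_clone \<kappa> S M \<Longrightarrow> clone_iso \<kappa> S M M (\<lambda>_ _ _ x. x)"
  by (rule clone_isoI) (auto simp: bij_betw_def PiE_restrict)

lemma clone_iso_trans:
  assumes \<phi>: "clone_iso \<kappa> S M N \<phi>" and \<psi>: "clone_iso \<kappa> S N Q \<psi>"
  shows "clone_iso \<kappa> S M Q (\<lambda>l v s x. \<psi> l v s (\<phi> l v s x))"
proof (rule clone_isoI)
  fix l v s assume "l \<in> cardinals \<kappa>" "v \<in> sortings \<kappa> S l" "s \<in> underS \<kappa> S"
  then show "bij_betw (\<lambda>x. \<psi> l v s (\<phi> l v s x)) (cl_ops M l v s) (cl_ops Q l v s)"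
    using bij_betw_trans[OF clone_iso_bij[OF \<phi>] clone_iso_bij[OF \<psi>]] by (simp add: comp_def)
next
  fix l1 l2 v1 v2 s f g
  assume *: "l1 \<in> cardinals \<kappa>" "l2 \<in> cardinals \<kappa>" "v1 \<in> sortings \<kappa> S l1" "v2 \<in> sortings \<kappa> S l2"
    "s \<in> underS \<kappa> S" "f \<in> cl_ops M l1 v1 s" and g: "g \<in> families \<kappa> M l1 v1 l2 v2"
  have "(\<lambda>i\<in>underS \<kappa> l1. \<phi> l2 v2 (v1 i) (g i)) \<in> families \<kappa> N l1 v1 l2 v2"
    using * PiE_mem[OF g] PiE_mem[OF *(3)] by (simp add: clone_iso_mem[OF \<phi>])
  then show "\<psi> l2 v2 s (\<phi> l2 v2 s (cl_comp M l1 v1 l2 v2 s f g)) =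
      cl_comp Q l1 v1 l2 v2 s (\<psi> l1 v1 s (\<phi> l1 v1 s f))
        (\<lambda>i\<in>underS \<kappa> l1. \<psi> l2 v2 (v1 i) (\<phi> l2 v2 (v1 i) (g i)))"
    using * g by (simp add: clone_iso_comp[OF \<phi>] clone_iso_comp[OF \<psi>] clone_iso_mem[OF \<phi>]
        cong: restrict_cong)
qed (simp add: clone_iso_proj[OF \<phi>] clone_iso_proj[OF \<psi>])

section \<open>Inverse isomorphisms and transport of the clone structure\<close>

definition inv_iso ::
  "('k, 'a) clone \<Rightarrow> ('k \<Rightarrow> ('k \<Rightarrow> 'k) \<Rightarrow> 'k \<Rightarrow> 'a \<Rightarrow> 'b) \<Rightarrow> 'k \<Rightarrow> ('k \<Rightarrow> 'k) \<Rightarrow> 'k \<Rightarrow> 'b \<Rightarrow> 'a" where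
  "inv_iso M \<phi> l v s = the_inv_into (cl_ops M l v s) (\<phi> l v s)"

context
  fixes \<kappa> :: "'k rel" and S :: 'k and M :: "('k, 'a) clone" and N :: "('k, 'b) clone" and \<phi>
  assumes \<phi>: "clone_iso \<kappa> S M N \<phi>"
begin

lemma inv_iso_bij:
  assumes "l \<in> cardinals \<kappa>" "v \<in> sortings \<kappa> S l" "s \<in> underS \<kappa> S"
  shows "bij_betw (inv_iso M \<phi> l v s) (cl_ops N l v s) (cl_ops M l v s)"
  using clone_iso_bij[OF \<phi> assms] unfolding inv_iso_def by (rule bij_betw_the_inv_into)

lemma inv_iso_mem:
  assumes "l \<in> cardinals \<kappa>" "v \<in> sortings \<kappa> S l" "s \<in> underS \<kappa> S" "f \<in> cl_ops N l v s"
  shows "inv_iso M \<phi> l v s f \<in> cl_ops M l v s"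
  using bij_betw_apply[OF inv_iso_bij] assms by blast

lemma inv_iso_left:
  assumes "l \<in> cardinals \<kappa>" "v \<in> sortings \<kappa> S l" "s \<in> underS \<kappa> S" "f \<in> cl_ops M l v s"
  shows "inv_iso M \<phi> l v s (\<phi> l v s f) = f"
  using clone_iso_bij[OF \<phi> assms(1-3)] assms(4)
  unfolding inv_iso_def bij_betw_def by (auto intro: the_inv_into_f_f)

lemma inv_iso_right:
  assumes "l \<in> cardinals \<kappa>" "v \<in> sortings \<kappa> S l" "s \<in> underS \<kappa> S" "f \<in> cl_ops N l v s"
  shows "\<phi> l v s (inv_iso M \<phi> l v s f) = f"
  using clone_iso_bij[OF \<phi> assms(1-3)] assms(4)
  unfolding inv_iso_def by (rule f_the_inv_into_f_bij_betw)

lemma inv_iso_families: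
  assumes "l1 \<in> cardinals \<kappa>" "l2 \<in> cardinals \<kappa>" "v1 \<in> sortings \<kappa> S l1" "v2 \<in> sortings \<kappa> S l2"
    and g: "g \<in> families \<kappa> N l1 v1 l2 v2"
  shows "(\<lambda>i\<in>underS \<kappa> l1. inv_iso M \<phi> l2 v2 (v1 i) (g i)) \<in> families \<kappa> M l1 v1 l2 v2"
  using assms PiE_mem[OF g] PiE_mem[OF assms(3)] by (simp add: inv_iso_mem)

text \<open>The inner restricted family stays unreduced because this is the shape that
  \<open>clone_iso_comp\<close> produces for a family of inverse images. Outside the index set both
  sides take the default value of extensional functions.\<close>

lemma inv_iso_families_right:
  assumes "l1 \<in> cardinals \<kappa>" "l2 \<in> cardinals \<kappa>" "v1 \<in> sortings \<kappa> S l1" "v2 \<in> sortings \<kappa> S l2"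
    and g: "g \<in> families \<kappa> N l1 v1 l2 v2"
  shows "(\<lambda>i\<in>underS \<kappa> l1. \<phi> l2 v2 (v1 i) ((\<lambda>i\<in>underS \<kappa> l1. inv_iso M \<phi> l2 v2 (v1 i) (g i)) i)) = g"
    (is "?L = g")
proof
  fix i show "?L i = g i"
    using assms PiE_mem[OF g, of i] PiE_arb[OF g, of i]
    by (cases "i \<in> underS \<kappa> l1") (simp_all add: inv_iso_right sorting_mem)
qed

text \<open>Every argument in \<open>N\<close> is the image of its inverse image, so composition in
  \<open>N\<close> is that of \<open>M\<close> conjugated by \<phi>. Closure and associativity in
  \<open>N\<close> are reduced to \<open>M\<close> by this formula.\<close>

lemma clone_iso_comp_inv:
  assumes "l1 \<in> cardinals \<kappa>" "l2 \<in> cardinals \<kappa>" "v1 \<in> sortings \<kappa> S l1" "v2 \<in> sortings \<kappa> S l2"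
    "s \<in> underS \<kappa> S" "f \<in> cl_ops N l1 v1 s" "g \<in> families \<kappa> N l1 v1 l2 v2"
  shows "cl_comp N l1 v1 l2 v2 s f g = \<phi> l2 v2 s (cl_comp M l1 v1 l2 v2 s
    (inv_iso M \<phi> l1 v1 s f) (\<lambda>i\<in>underS \<kappa> l1. inv_iso M \<phi> l2 v2 (v1 i) (g i)))"
  unfolding clone_iso_comp[OF \<phi> assms(1-5) inv_iso_mem[OF assms(1,3,5,6)]
      inv_iso_families[OF assms(1-4,7)]]
  by (simp only: inv_iso_families_right[OF assms(1-4,7)] inv_iso_right[OF assms(1,3,5,6)])

context
  assumes M: "is_clone \<kappa> S M"
begin

text \<open>\<open>inv_iso\<close> cancels \<phi> only on operations of \<open>M\<close>; since
  \<open>M\<close> is a clone, projections and composites are such operations.\<close>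

lemma clone_iso_sym: "clone_iso \<kappa> S N M (inv_iso M \<phi>)"
proof (rule clone_isoI)
  fix l v i assume "l \<in> cardinals \<kappa>" "v \<in> sortings \<kappa> S l" "i \<in> underS \<kappa> l"
  then show "inv_iso M \<phi> l v (v i) (cl_proj N l v i) = cl_proj M l v i"
    by (metis inv_iso_left clone_proj_mem[OF M] clone_iso_proj[OF \<phi>] sorting_mem)
next
  fix l1 l2 v1 v2 s f g
  assume *: "l1 \<in> cardinals \<kappa>" "l2 \<in> cardinals \<kappa>" "v1 \<in> sortings \<kappa> S l1" "v2 \<in> sortings \<kappa> S l2"
    "s \<in> underS \<kappa> S" "f \<in> cl_ops N l1 v1 s" "g \<in> families \<kappa> N l1 v1 l2 v2"
  show "inv_iso M \<phi> l2 v2 s (cl_comp N l1 v1 l2 v2 s f g) = cl_comp M l1 v1 l2 v2 s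
      (inv_iso M \<phi> l1 v1 s f) (\<lambda>i\<in>underS \<kappa> l1. inv_iso M \<phi> l2 v2 (v1 i) (g i))"
    using * by (simp only: clone_iso_comp_inv)
      (intro inv_iso_left clone_comp_mem[OF M] inv_iso_mem inv_iso_families)
qed (rule inv_iso_bij)

text \<open>\<open>N\<close> is only known as the target of an isomorphism. Each law is checked on
  inverse images in \<open>M\<close> and carried over by \<phi>; this is how clones are later
  obtained by transport.\<close>

lemma clone_iso_is_clone: "is_clone \<kappa> S N"
proof (rule is_cloneI)
  fix l v i assume "l \<in> cardinals \<kappa>" "v \<in> sortings \<kappa> S l" "i \<in> underS \<kappa> l"
  then show "cl_proj N l v i \<in> cl_ops N l v (v i)"
    by (metis clone_proj_mem[OF M] clone_iso_proj[OF \<phi>] clone_iso_mem[OF \<phi>] sorting_mem)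
next
  fix l1 l2 v1 v2 s f g
  assume *: "l1 \<in> cardinals \<kappa>" "l2 \<in> cardinals \<kappa>" "v1 \<in> sortings \<kappa> S l1" "v2 \<in> sortings \<kappa> S l2"
    "s \<in> underS \<kappa> S" "f \<in> cl_ops N l1 v1 s" "g \<in> families \<kappa> N l1 v1 l2 v2"
  then show "cl_comp N l1 v1 l2 v2 s f g \<in> cl_ops N l2 v2 s"
    by (simp only: clone_iso_comp_inv)
      (intro clone_iso_mem[OF \<phi>] clone_comp_mem[OF M] inv_iso_mem inv_iso_families)
next
  fix l1 l2 l3 v1 v2 v3 s f g h
  assume *: "l1 \<in> cardinals \<kappa>" "l2 \<in> cardinals \<kappa>" "l3 \<in> cardinals \<kappa>" "v1 \<in> sortings \<kappa> S l1"
    "v2 \<in> sortings \<kappa> S l2" "v3 \<in> sortings \<kappa> S l3" "s \<in> underS \<kappa> S" "f \<in> cl_ops N l1 v1 s"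
    and g: "g \<in> families \<kappa> N l1 v1 l2 v2" and h: "h \<in> families \<kappa> N l2 v2 l3 v3"
  let ?f = "inv_iso M \<phi> l1 v1 s f"
  let ?g = "\<lambda>i\<in>underS \<kappa> l1. inv_iso M \<phi> l2 v2 (v1 i) (g i)"
  let ?h = "\<lambda>i\<in>underS \<kappa> l2. inv_iso M \<phi> l3 v3 (v2 i) (h i)"
  have f': "?f \<in> cl_ops M l1 v1 s" and g': "?g \<in> families \<kappa> M l1 v1 l2 v2"
    and h': "?h \<in> families \<kappa> M l2 v2 l3 v3"
    using * g h by (auto intro!: inv_iso_mem inv_iso_families simp del: restrict_PiE_iff)
  have gh: "(\<lambda>i\<in>underS \<kappa> l1. cl_comp M l2 v2 l3 v3 (v1 i) (?g i) ?h) \<in> families \<kappa> M l1 v1 l3 v3"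
    using clone_comp_families[OF M *(1-6) g' h'] .
  have "cl_comp N l2 v2 l3 v3 s (cl_comp N l1 v1 l2 v2 s f g) h =
      \<phi> l3 v3 s (cl_comp M l2 v2 l3 v3 s (cl_comp M l1 v1 l2 v2 s ?f ?g) ?h)"
    unfolding clone_iso_comp[OF \<phi> *(2,3,5,6,7) clone_comp_mem[OF M *(1,2,4,5,7) f' g'] h']
      inv_iso_families_right[OF *(2,3,5,6) h] clone_iso_comp_inv[OF *(1,2,4,5,7,8) g] ..
  also have "\<dots> = \<phi> l3 v3 s (cl_comp M l1 v1 l3 v3 s ?f
        (\<lambda>i\<in>underS \<kappa> l1. cl_comp M l2 v2 l3 v3 (v1 i) (?g i) ?h))"
    using * f' g' h' by (simp only: clone_comp_assoc[OF M])
  also have "\<dots> = cl_comp N l1 v1 l3 v3 s f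
      (\<lambda>i\<in>underS \<kappa> l1. \<phi> l3 v3 (v1 i) ((\<lambda>i\<in>underS \<kappa> l1. cl_comp M l2 v2 l3 v3 (v1 i) (?g i) ?h) i))"
    by (subst clone_iso_comp[OF \<phi>], use * f' gh in \<open>simp_all only: inv_iso_right\<close>)
  also have "(\<lambda>i\<in>underS \<kappa> l1. \<phi> l3 v3 (v1 i) ((\<lambda>i\<in>underS \<kappa> l1. cl_comp M l2 v2 l3 v3 (v1 i) (?g i) ?h) i))
      = (\<lambda>i\<in>underS \<kappa> l1. cl_comp N l2 v2 l3 v3 (v1 i) (g i) h)"
    by (rule restrict_ext, subst clone_iso_comp_inv) (use * PiE_mem[OF g] h in \<open>simp_all add: sorting_mem\<close>)
  finally show "cl_comp N l2 v2 l3 v3 s (cl_comp N l1 v1 l2 v2 s f g) h =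
      cl_comp N l1 v1 l3 v3 s f (\<lambda>i\<in>underS \<kappa> l1. cl_comp N l2 v2 l3 v3 (v1 i) (g i) h)" .
next
  fix l1 l2 v1 v2 j g
  assume *: "l1 \<in> cardinals \<kappa>" "l2 \<in> cardinals \<kappa>" "v1 \<in> sortings \<kappa> S l1" "v2 \<in> sortings \<kappa> S l2"
    "j \<in> underS \<kappa> l1" and g: "g \<in> families \<kappa> N l1 v1 l2 v2"
  let ?g = "\<lambda>i\<in>underS \<kappa> l1. inv_iso M \<phi> l2 v2 (v1 i) (g i)"
  have "\<phi> l2 v2 (v1 j) (cl_comp M l1 v1 l2 v2 (v1 j) (cl_proj M l1 v1 j) ?g) =
      cl_comp N l1 v1 l2 v2 (v1 j) (cl_proj N l1 v1 j) g"
    by (subst clone_iso_comp[OF \<phi>],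
        use * inv_iso_families[OF *(1-4) g] in \<open>simp_all only: sorting_mem clone_proj_mem[OF M]
          clone_iso_proj[OF \<phi>] inv_iso_families_right[OF *(1-4) g]\<close>)
  moreover have "cl_comp M l1 v1 l2 v2 (v1 j) (cl_proj M l1 v1 j) ?g = ?g j"
    using * inv_iso_families[OF *(1-4) g] by (intro clone_proj_comp[OF M]) simp_all
  ultimately show "cl_comp N l1 v1 l2 v2 (v1 j) (cl_proj N l1 v1 j) g = g j"
    using * PiE_mem[OF g] by (simp add: inv_iso_right sorting_mem)
next
  fix l v s f assume *: "l \<in> cardinals \<kappa>" "v \<in> sortings \<kappa> S l" "s \<in> underS \<kappa> S" "f \<in> cl_ops N l v s"
  have "\<phi> l v s (cl_comp M l v l v s (inv_iso M \<phi> l v s f) (\<lambda>i\<in>underS \<kappa> l. cl_proj M l v i)) =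
      cl_comp N l v l v s f (\<lambda>i\<in>underS \<kappa> l. cl_proj N l v i)"
    by (subst clone_iso_comp[OF \<phi>], use * in \<open>simp_all add: inv_iso_mem inv_iso_right
        clone_proj_mem[OF M] clone_iso_proj[OF \<phi>] cong: restrict_cong\<close>)
  then show "cl_comp N l v l v s f (\<lambda>i\<in>underS \<kappa> l. cl_proj N l v i) = f"
    using * by (simp add: clone_comp_proj[OF M] inv_iso_mem inv_iso_right)
qed

end

end

lemma clone_isomorphic_refl: "is_clone \<kappa> S M \<Longrightarrow> clone_isomorphic \<kappa> S M M"
  unfolding clone_isomorphic_def by (rule exI) (rule clone_iso_refl)

lemma clone_isomorphic_sym:
  "clone_isomorphic \<kappa> S M N \<Longrightarrow> is_clone \<kappa> S M \<Longrightarrow> clone_isomorphic \<kappa> S N M"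
  unfolding clone_isomorphic_def by (elim exE) (rule exI, rule clone_iso_sym)

lemma clone_isomorphic_trans:
  "clone_isomorphic \<kappa> S M N \<Longrightarrow> clone_isomorphic \<kappa> S N Q \<Longrightarrow> clone_isomorphic \<kappa> S M Q"
  unfolding clone_isomorphic_def by (elim exE) (rule exI, rule clone_iso_trans)

unbundle cardinal_syntax

section \<open>Sets of size below \<open>\<kappa>\<close>\<close>

context
  fixes \<kappa> :: "'k rel"
  assumes \<kappa>: "Card_order \<kappa>"
begin

lemma wo_\<kappa>: "Well_order \<kappa>"
  using \<kappa> by (rule card_order_on_well_order_on)

lemma Field_Restr_underS: "Field (Restr \<kappa> (underS \<kappa> l)) = underS \<kappa> l"
  using wo_\<kappa> by (intro Field_Restr_ofilter wo_rel.underS_ofilter) (auto simp: wo_rel_def)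

lemma underS_le_iff:
  "a \<in> Field \<kappa> \<Longrightarrow> b \<in> Field \<kappa> \<Longrightarrow> underS \<kappa> a \<subseteq> underS \<kappa> b \<longleftrightarrow> (a, b) \<in> \<kappa>"
  using wo_\<kappa> by (intro underS_incl_iff) (simp_all add: well_order_on_def)

lemma underS_eqD: "a \<in> Field \<kappa> \<Longrightarrow> b \<in> Field \<kappa> \<Longrightarrow> underS \<kappa> a = underS \<kappa> b \<Longrightarrow> a = b"
  using underS_le_iff[of a b] underS_le_iff[of b a] wo_\<kappa>
  by (auto simp: order_on_defs dest: antisymD)

text \<open>For a member of \<open>cardinals \<kappa>\<close>, the order on its predecessors is
  isomorphic to the cardinal of that set. Initial segments are nested, and a proper inclusion would
  make one of the two orders strictly shorter.\<close>

lemma cardinal_unique: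
  assumes "l \<in> cardinals \<kappa>" "l' \<in> cardinals \<kappa>" and eq: "|underS \<kappa> l| =o |underS \<kappa> l'|"
  shows "l = l'"
proof -
  have iso: "Restr \<kappa> (underS \<kappa> a) =o |underS \<kappa> a|" if "a \<in> cardinals \<kappa>" for a
    using that Card_order_iff_ordIso_card_of[of "Restr \<kappa> (underS \<kappa> a)"]
    by (simp add: cardinals_def Field_Restr_underS)
  have *: "Restr \<kappa> (underS \<kappa> l) =o Restr \<kappa> (underS \<kappa> l')"
    using ordIso_transitive[OF ordIso_transitive[OF iso eq] ordIso_symmetric[OF iso]] assms by blast
  have less: "Restr \<kappa> (underS \<kappa> a) <o Restr \<kappa> (underS \<kappa> b)" if "underS \<kappa> a \<subset> underS \<kappa> b" for a b
    using that ofilter_subset_ordLess[OF wo_\<kappa>] wo_rel.underS_ofilter wo_\<kappa>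
    by (metis wo_rel_def)
  have field: "l \<in> Field \<kappa>" "l' \<in> Field \<kappa>"
    using assms by (auto simp: cardinals_def)
  have "underS \<kappa> l \<subseteq> underS \<kappa> l' \<or> underS \<kappa> l' \<subseteq> underS \<kappa> l"
    using field underS_le_iff wo_\<kappa> by (metis wo_rel.TOTALS wo_rel_def)
  moreover have "\<not> underS \<kappa> l \<subset> underS \<kappa> l'" "\<not> underS \<kappa> l' \<subset> underS \<kappa> l"
    using less * ordIso_symmetric not_ordLess_ordIso by blast+
  ultimately show ?thesis
    using underS_eqD field by blast
qed

text \<open>A well-order below \<kappa> is isomorphic to an initial segment of \<kappa>, and a
  segment isomorphic to \<open>|A|\<close> is itself a cardinal order.\<close>

lemma ex_cardinal:
  assumes "|A| <o \<kappa>"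
  shows "\<exists>l\<in>cardinals \<kappa>. \<exists>b. bij_betw b (underS \<kappa> l) A"
proof -
  obtain l where l: "l \<in> Field \<kappa>" "|A| =o Restr \<kappa> (underS \<kappa> l)"
    using assms ordLess_iff_ordIso_Restr[OF wo_\<kappa> card_of_Well_order] by blast
  have card: "Card_order (Restr \<kappa> (underS \<kappa> l))"
    using Card_order_ordIso2[OF card_of_Card_order l(2)] .
  have "|underS \<kappa> l| =o |A|"
    using card_of_Field_ordIso[OF card] l(2)
    unfolding Field_Restr_underS by (blast intro: ordIso_transitive ordIso_symmetric)
  then show ?thesis
    using l(1) card card_of_ordIso unfolding cardinals_def by blast
qed

text \<open>\<open>ex_cardinal\<close> and \<open>cardinal_unique\<close> discharge the
  \<open>THE\<close> and the \<open>SOME\<close> in the definitions of arities.\<close>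

lemma arity_card_bij:
  assumes "|A| <o \<kappa>"
  shows "arity_card \<kappa> A \<in> cardinals \<kappa>"
    and "bij_betw (arity_bij \<kappa> A) (underS \<kappa> (arity_card \<kappa> A)) A"
proof -
  have "\<exists>!l. l \<in> cardinals \<kappa> \<and> (\<exists>b. bij_betw b (underS \<kappa> l) A)"
  proof -
    have "l = l'" if "l \<in> cardinals \<kappa>" "bij_betw b (underS \<kappa> l) A"
      "l' \<in> cardinals \<kappa>" "bij_betw b' (underS \<kappa> l') A" for l l' b b'
      using that cardinal_unique
      by (meson card_of_ordIsoI ordIso_symmetric ordIso_transitive)
    then show ?thesis using ex_cardinal[OF assms] by blast
  qed
  from theI'[OF this] show "arity_card \<kappa> A \<in> cardinals \<kappa>"
    "bij_betw (arity_bij \<kappa> A) (underS \<kappa> (arity_card \<kappa> A)) A"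
    unfolding arity_card_def[symmetric] arity_bij_def by (blast, metis someI_ex)
qed

context
  assumes inf: "infinite (Field \<kappa>)"
begin

lemma finite_small: "finite A \<Longrightarrow> |A| <o \<kappa>"
  using finite_ordLess_infinite[OF card_of_Well_order wo_\<kappa>] inf by (simp add: Field_card_of)

text \<open>Finite sets are small because \<kappa> is infinite; otherwise the larger factor is
  infinite and absorbs the other.\<close>

lemma times_small:
  assumes "|A| <o \<kappa>" "|B| <o \<kappa>"
  shows "|A \<times> B| <o \<kappa>"
proof (cases "finite A \<and> finite B")
  case True
  then show ?thesis by (intro finite_small) simp
next
  case False
  from ordLeq_total[OF card_of_Well_order card_of_Well_order, of A B]
  show ?thesis
  proof
    assume le: "|A| \<le>o |B|"
    then have "infinite B" using False by (meson card_of_ordLeq_finite)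
    then have "|A \<times> B| \<le>o |B|"
      using le by (intro card_of_Times_ordLeq_infinite_Field)
        (simp_all add: Field_card_of card_of_card_order_on card_of_mono1)
    then show ?thesis using assms(2) by (rule ordLeq_ordLess_trans)
  next
    assume le: "|B| \<le>o |A|"
    then have "infinite A" using False by (meson card_of_ordLeq_finite)
    then have "|A \<times> B| \<le>o |A|"
      using le by (intro card_of_Times_ordLeq_infinite_Field)
        (simp_all add: Field_card_of card_of_card_order_on card_of_mono1)
    then show ?thesis using assms(1) by (rule ordLeq_ordLess_trans)
  qed
qed

lemma ord0_props: "ord0 \<kappa> \<in> Field \<kappa>" "underS \<kappa> (ord0 \<kappa>) = {}"
proof -
  obtain l b where "l \<in> cardinals \<kappa>" "bij_betw b (underS \<kappa> l) ({} :: 'k set)"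
    using ex_cardinal[OF finite_small[OF finite.emptyI]] by blast
  then have "l \<in> Field \<kappa> \<and> underS \<kappa> l = {}"
    by (simp add: cardinals_def bij_betw_def)
  then have "\<exists>!l. l \<in> Field \<kappa> \<and> underS \<kappa> l = {}"
    using underS_eqD by metis
  from theI'[OF this] show "ord0 \<kappa> \<in> Field \<kappa>" "underS \<kappa> (ord0 \<kappa>) = {}"
    unfolding ord0_def by blast+
qed

lemma ord0_mem:
  assumes "l \<in> Field \<kappa>" "l \<noteq> ord0 \<kappa>"
  shows "ord0 \<kappa> \<in> underS \<kappa> l"
  using assms ord0_props underS_le_iff[of "ord0 \<kappa>" l] unfolding underS_def by auto

lemma ord1_props: "ord1 \<kappa> \<in> cardinals \<kappa>" "underS \<kappa> (ord1 \<kappa>) = {ord0 \<kappa>}"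
proof -
  obtain l b where l: "l \<in> cardinals \<kappa>" "bij_betw b (underS \<kappa> l) {ord0 \<kappa>}"
    using ex_cardinal[OF finite_small[of "{ord0 \<kappa>}"]] by blast
  then have "l \<in> Field \<kappa>"
    by (simp add: cardinals_def)
  have "card (underS \<kappa> l) = 1"
    using bij_betw_same_card[OF l(2)] by simp
  then obtain x where x: "underS \<kappa> l = {x}"
    by (rule card_1_singletonE)
  \<comment> \<open>The single predecessor must be \<open>ord0 \<kappa>\<close>, which lies below
    every other element of the field.\<close>
  then have "ord0 \<kappa> \<in> underS \<kappa> l"
    using ord0_props ord0_mem[OF \<open>l \<in> Field \<kappa>\<close>] by (cases "l = ord0 \<kappa>") auto
  then have "l \<in> Field \<kappa> \<and> underS \<kappa> l = {ord0 \<kappa>}"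
    using \<open>l \<in> Field \<kappa>\<close> x by simp
  moreover from this have "ord1 \<kappa> = l"
    unfolding ord1_def using underS_eqD by (intro the_equality) auto
  ultimately show "ord1 \<kappa> \<in> cardinals \<kappa>" "underS \<kappa> (ord1 \<kappa>) = {ord0 \<kappa>}"
    using l(1) by auto
qed

end

end

declare restrict_cong [cong]

text \<open>Together with \<open>restrict_cong\<close>, this lets the simplifier assume that a bound
  index lies in the index set, so that clone laws with membership premises rewrite inside
  families.\<close>

lemma PiE_cong_simp [cong]:
  "I = J \<Longrightarrow> (\<And>i. i \<in> J \<Longrightarrow> A i = B i) \<Longrightarrow> Pi\<^sub>E I A = Pi\<^sub>E J B"
  by hypsubst (rule PiE_cong)

section \<open>The arities \<open>l \<times> S\<close> and the homogenization in terms of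
  positions\<close>

locale sort_cardinal =
  fixes \<kappa> :: "'k rel" and S :: 'k
  assumes Card_\<kappa>: "Card_order \<kappa>" and infinite_\<kappa>: "infinite (Field \<kappa>)"
    and S_cardinal [simp]: "S \<in> cardinals \<kappa>" and S_nonzero: "S \<noteq> ord0 \<kappa>"
begin

abbreviation "K \<equiv> cardinals \<kappa>"
abbreviation "U \<equiv> underS \<kappa>"
abbreviation "zero \<equiv> ord0 \<kappa>"
abbreviation "one \<equiv> ord1 \<kappa>"

lemma one_cardinal [simp]: "one \<in> K"
  using ord1_props[OF Card_\<kappa> infinite_\<kappa>] by simp

lemma U_one [simp]: "U one = {zero}"
  using ord1_props[OF Card_\<kappa> infinite_\<kappa>] by simp

lemma zero_U_S [simp]: "zero \<in> U S"
  using S_cardinal S_nonzero by (intro ord0_mem[OF Card_\<kappa> infinite_\<kappa>]) (simp_all add: cardinals_def)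

text \<open>
  \<open>pcard l\<close>, with the sorting \<open>psort l\<close>, is the arity that stands for \<open>(l \<times> S, p\<^sub>2)\<close>; its position \<open>j\<close>
  stands for the pair \<open>(pfst l j, psnd l j)\<close>, and \<open>pidx l i s\<close> is the position of \<open>(i, s)\<close>.
\<close>

definition "pcard l = arity_card \<kappa> (U l \<times> U S)"
definition "psort l = arity_map \<kappa> (U l \<times> U S) snd"
definition "pfst l j = fst (arity_bij \<kappa> (U l \<times> U S) j)"
definition "psnd l j = snd (arity_bij \<kappa> (U l \<times> U S) j)"
definition "pidx l i s = the_inv_into (U (pcard l)) (arity_bij \<kappa> (U l \<times> U S)) (i, s)"

lemma times_bij:
  assumes "l \<in> K"
  shows "pcard l \<in> K" "bij_betw (arity_bij \<kappa> (U l \<times> U S)) (U (pcard l)) (U l \<times> U S)"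
proof -
  have "|U l| <o \<kappa>" "|U S| <o \<kappa>"
    using assms S_cardinal by (auto intro!: card_of_underS Card_\<kappa> simp: cardinals_def)
  from arity_card_bij[OF Card_\<kappa> times_small[OF Card_\<kappa> infinite_\<kappa> this]]
  show "pcard l \<in> K" "bij_betw (arity_bij \<kappa> (U l \<times> U S)) (U (pcard l)) (U l \<times> U S)"
    by (simp_all add: pcard_def)
qed

declare times_bij(1) [simp]

lemma pfst_mem [simp]: "l \<in> K \<Longrightarrow> j \<in> U (pcard l) \<Longrightarrow> pfst l j \<in> U l"
  and psnd_mem [simp]: "l \<in> K \<Longrightarrow> j \<in> U (pcard l) \<Longrightarrow> psnd l j \<in> U S"
  using bij_betw_apply[OF times_bij(2), of l j] by (auto simp: pfst_def psnd_def mem_Times_iff)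

lemma pfst_one [simp]: "j \<in> U (pcard one) \<Longrightarrow> pfst one j = zero"
  using pfst_mem[of one j] by simp

lemma psort_apply [simp]: "j \<in> U (pcard l) \<Longrightarrow> psort l j = psnd l j"
  by (simp add: psort_def arity_map_def psnd_def pcard_def)

lemma psort_mem [simp]: "l \<in> K \<Longrightarrow> psort l \<in> sortings \<kappa> S (pcard l)"
  using psnd_mem by (auto simp: psort_def arity_map_def pcard_def psnd_def)

lemma pidx_mem [simp]: "l \<in> K \<Longrightarrow> i \<in> U l \<Longrightarrow> s \<in> U S \<Longrightarrow> pidx l i s \<in> U (pcard l)"
  unfolding pidx_def
  by (rule bij_betw_apply[OF bij_betw_the_inv_into[OF times_bij(2)]]) simp_all

lemma pfst_pidx [simp]: "l \<in> K \<Longrightarrow> i \<in> U l \<Longrightarrow> s \<in> U S \<Longrightarrow> pfst l (pidx l i s) = i"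
  and psnd_pidx [simp]: "l \<in> K \<Longrightarrow> i \<in> U l \<Longrightarrow> s \<in> U S \<Longrightarrow> psnd l (pidx l i s) = s"
  unfolding pidx_def pfst_def psnd_def
  by (simp_all add: f_the_inv_into_f_bij_betw[OF times_bij(2)])

lemma pidx_pfst_psnd [simp]: "l \<in> K \<Longrightarrow> j \<in> U (pcard l) \<Longrightarrow> pidx l (pfst l j) (psnd l j) = j"
  unfolding pidx_def pfst_def psnd_def
  using times_bij(2)[of l] by (simp add: the_inv_into_f_f bij_betw_def)

lemma hom_ops: "cl_ops (homogenization \<kappa> S M) l v s = (\<Pi>\<^sub>E s\<in>U S. cl_ops M (pcard l) (psort l) s)"
  by (simp add: homogenization_def set_ops_def pcard_def psort_def)

lemma hom_proj: "cl_proj (homogenization \<kappa> S M) l v i =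
    (\<lambda>s\<in>U S. cl_proj M (pcard l) (psort l) (pidx l i s))"
  by (simp add: homogenization_def set_proj_def pcard_def psort_def pidx_def)

lemma hom_comp: "cl_comp (homogenization \<kappa> S M) l1 v1 l2 v2 r f g =
    (\<lambda>s\<in>U S. cl_comp M (pcard l1) (psort l1) (pcard l2) (psort l2) s (f s)
       (\<lambda>j\<in>U (pcard l1). g (pfst l1 j) (psnd l1 j)))"
  by (simp add: homogenization_def set_comp_def pcard_def psort_def arity_map_def pfst_def psnd_def
      case_prod_beta)

lemma hom_diag: "homogenization_diag \<kappa> S M =
    (\<lambda>s\<in>U S. cl_proj M (pcard S) (psort S) (pidx S s s))"
  by (simp add: homogenization_diag_def set_proj_def pcard_def psort_def pidx_def)

text \<open>The only map from \<open>l\<close> to 1 is a constant family; folding keeps it in the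
  form in which the single-sorted notions are stated.\<close>

lemmas const_sort_fold [simp] = const_sort_def[symmetric]

lemma const_sort_apply [simp]: "i \<in> U l \<Longrightarrow> const_sort \<kappa> l i = zero"
  by (simp add: const_sort_def del: const_sort_fold)

end

section \<open>Single-sorted clones\<close>

locale single_clone = sort_cardinal \<kappa> S for \<kappa> :: "'k rel" and S +
  fixes C :: "('k, 'a) clone"
  assumes single: "single_sorted \<kappa> C"
begin

abbreviation "ops \<equiv> ss_ops \<kappa> C"
abbreviation "pr \<equiv> ss_proj \<kappa> C"
abbreviation "cmp \<equiv> ss_comp \<kappa> C"
abbreviation "un \<equiv> ss_unary \<kappa> C"

lemma ss_proj_mem [simp]: "l \<in> K \<Longrightarrow> i \<in> U l \<Longrightarrow> pr l i \<in> ops l"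
  unfolding ss_ops_def ss_proj_def by (rule clone_proj_mem[OF single]) simp_all

lemma ss_comp_mem [simp]:
  "l \<in> K \<Longrightarrow> m \<in> K \<Longrightarrow> f \<in> ops l \<Longrightarrow> g \<in> U l \<rightarrow>\<^sub>E ops m \<Longrightarrow> cmp l m f g \<in> ops m"
  using clone_comp_mem[OF single, of l m "const_sort \<kappa> l" "const_sort \<kappa> m" zero f g]
  by (simp add: ss_ops_def ss_comp_def)

lemma ss_comp_assoc [simp]:
  assumes "l \<in> K" "m \<in> K" "n \<in> K" "f \<in> ops l" "g \<in> U l \<rightarrow>\<^sub>E ops m" "h \<in> U m \<rightarrow>\<^sub>E ops n"
  shows "cmp m n (cmp l m f g) h = cmp l n f (\<lambda>i\<in>U l. cmp m n (g i) h)"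
proof -
  have "(\<lambda>i\<in>U l. cl_comp C m (const_sort \<kappa> m) n (const_sort \<kappa> n) (const_sort \<kappa> l i) (g i) h) =
      (\<lambda>i\<in>U l. cmp m n (g i) h)"
    by (simp add: ss_comp_def)
  then show ?thesis
    using clone_comp_assoc[OF single, of l m n "const_sort \<kappa> l" "const_sort \<kappa> m" "const_sort \<kappa> n" zero f g h]
      assms
    by (simp add: ss_ops_def ss_comp_def)
qed

lemma ss_proj_comp [simp]:
  "l \<in> K \<Longrightarrow> m \<in> K \<Longrightarrow> i \<in> U l \<Longrightarrow> g \<in> U l \<rightarrow>\<^sub>E ops m \<Longrightarrow> cmp l m (pr l i) g = g i"
  using clone_proj_comp[OF single, of l m "const_sort \<kappa> l" "const_sort \<kappa> m" i zero g]
  by (simp add: ss_ops_def ss_proj_def ss_comp_def)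

lemma ss_comp_proj [simp]: "l \<in> K \<Longrightarrow> f \<in> ops l \<Longrightarrow> cmp l l f (\<lambda>i\<in>U l. pr l i) = f"
  using clone_comp_proj[OF single, of l "const_sort \<kappa> l" zero f]
  by (simp add: ss_ops_def ss_proj_def[abs_def] ss_comp_def)

lemma ss_unary_mem [simp]: "l \<in> K \<Longrightarrow> u \<in> ops one \<Longrightarrow> f \<in> ops l \<Longrightarrow> un l u f \<in> ops l"
  unfolding ss_unary_def by (intro ss_comp_mem) simp_all

text \<open>Associativity for a unary outer operation. As a simp rule it moves \<open>u\<close>
  outermost, where the laws for the idempotents of a diagonal pair can act.\<close>

lemma ss_unary_comp [simp]:
  assumes "l \<in> K" "m \<in> K" "u \<in> ops one" "f \<in> ops l" "h \<in> U l \<rightarrow>\<^sub>E ops m"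
  shows "cmp l m (un l u f) h = un m u (cmp l m f h)"
  unfolding ss_unary_def using assms by simp

end

lemma (in sort_cardinal) single_sortedI:
  assumes "\<And>l i. l \<in> K \<Longrightarrow> i \<in> U l \<Longrightarrow> ss_proj \<kappa> C l i \<in> ss_ops \<kappa> C l"
    and "\<And>l m f g. l \<in> K \<Longrightarrow> m \<in> K \<Longrightarrow> f \<in> ss_ops \<kappa> C l \<Longrightarrow> g \<in> U l \<rightarrow>\<^sub>E ss_ops \<kappa> C m \<Longrightarrow>
      ss_comp \<kappa> C l m f g \<in> ss_ops \<kappa> C m"
    and "\<And>l m n f g h. l \<in> K \<Longrightarrow> m \<in> K \<Longrightarrow> n \<in> K \<Longrightarrow> f \<in> ss_ops \<kappa> C l \<Longrightarrow>
      g \<in> U l \<rightarrow>\<^sub>E ss_ops \<kappa> C m \<Longrightarrow> h \<in> U m \<rightarrow>\<^sub>E ss_ops \<kappa> C n \<Longrightarrow>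
      ss_comp \<kappa> C m n (ss_comp \<kappa> C l m f g) h = ss_comp \<kappa> C l n f (\<lambda>i\<in>U l. ss_comp \<kappa> C m n (g i) h)"
    and "\<And>l m i g. l \<in> K \<Longrightarrow> m \<in> K \<Longrightarrow> i \<in> U l \<Longrightarrow> g \<in> U l \<rightarrow>\<^sub>E ss_ops \<kappa> C m \<Longrightarrow>
      ss_comp \<kappa> C l m (ss_proj \<kappa> C l i) g = g i"
    and "\<And>l f. l \<in> K \<Longrightarrow> f \<in> ss_ops \<kappa> C l \<Longrightarrow> ss_comp \<kappa> C l l f (\<lambda>i\<in>U l. ss_proj \<kappa> C l i) = f"
  shows "single_sorted \<kappa> C"
  by (rule is_cloneI) (simp_all add: assms[unfolded ss_ops_def ss_proj_def ss_comp_def])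

text \<open>The clone of those representatives of the classes of \<^const>\<open>heterogenization\<close> that are fixed by
  precomposition with the idempotents; each class contains exactly one of them.\<close>

definition retract_clone :: "'k rel \<Rightarrow> ('k, 'a) clone \<Rightarrow> ('k \<Rightarrow> 'a) \<Rightarrow> ('k, 'a) clone" where
  "retract_clone \<kappa> C e =
     \<lparr>cl_ops = (\<lambda>l v t. {f \<in> het_carrier \<kappa> C e l t. het_restrict \<kappa> C e l v f = f}),
      cl_proj = (\<lambda>l v i. ss_unary \<kappa> C l (e (v i)) (ss_proj \<kappa> C l i)),
      cl_comp = (\<lambda>l1 v1 l2 v2 t f g. ss_comp \<kappa> C l1 l2 f g)\<rparr>"

lemma retract_ops_iff: "f \<in> cl_ops (retract_clone \<kappa> C e) l v t \<longleftrightarrow>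
    f \<in> ss_ops \<kappa> C l \<and> ss_unary \<kappa> C l (e t) f = f \<and> ss_comp \<kappa> C l l f (\<lambda>i\<in>underS \<kappa> l. ss_unary \<kappa> C l (e (v i)) (ss_proj \<kappa> C l i)) = f"
  by (simp add: retract_clone_def het_carrier_def het_restrict_def)

lemma retract_proj: "cl_proj (retract_clone \<kappa> C e) l v i = ss_unary \<kappa> C l (e (v i)) (ss_proj \<kappa> C l i)"
  and retract_comp: "cl_comp (retract_clone \<kappa> C e) l v m w t f g = ss_comp \<kappa> C l m f g"
  by (simp_all add: retract_clone_def)

section \<open>Diagonal pairs and the clone \<open>R\<close> of representatives\<close>

locale diagonal = single_clone \<kappa> S C for \<kappa> :: "'k rel" and S and C :: "('k, 'a) clone" +
  fixes d e
  assumes pair: "diagonal_pair \<kappa> S C d e"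
begin

lemma d_mem [simp]: "d \<in> ops S"
  and e_mem [simp]: "s \<in> U S \<Longrightarrow> e s \<in> ops one"
  using pair by (auto simp: diagonal_pair_def)

text \<open>This is axiom (1) composed with an arbitrary family; \<open>d_e\<close> and
  \<open>d_const\<close> do the same for (2) and (3). Read as simp rules, they make \<open>d\<close>
  a tupling operation from which \<open>e s\<close> extracts what it sees of entry
  \<open>s\<close>.\<close>

lemma e_d [simp]:
  assumes "l \<in> K" "s \<in> U S" "g \<in> U S \<rightarrow>\<^sub>E ops l"
  shows "un l (e s) (cmp S l d g) = un l (e s) (g s)"
proof -
  have "un l (e s) (cmp S l d g) = cmp S l (un S (e s) d) g"
    using assms by simp
  also have "un S (e s) d = un S (e s) (pr S s)"
    using pair assms(2) by (simp add: diagonal_pair_def)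
  finally show ?thesis
    using assms by simp
qed

lemma d_e [simp]:
  assumes "l \<in> K" "\<And>s. s \<in> U S \<Longrightarrow> g s \<in> ops l"
  shows "cmp S l d (\<lambda>s\<in>U S. un l (e s) (g s)) = cmp S l d (\<lambda>s\<in>U S. g s)"
proof -
  have "cmp S l (cmp S S d (\<lambda>s\<in>U S. un S (e s) (pr S s))) (\<lambda>s\<in>U S. g s) =
      cmp S l d (\<lambda>s\<in>U S. un l (e s) (g s))"
    using assms by (simp)
  then show ?thesis
    using pair by (simp add: diagonal_pair_def)
qed

lemma d_const [simp]:
  assumes "l \<in> K" "f \<in> ops l"
  shows "cmp S l d (\<lambda>s\<in>U S. f) = f"
proof -
  have "cmp S l (cmp S S d (\<lambda>s\<in>U S. pr S zero)) (\<lambda>s\<in>U S. f) = cmp S l d (\<lambda>s\<in>U S. f)"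
    using assms by (simp)
  moreover have "cmp S S d (\<lambda>s\<in>U S. pr S zero) = pr S zero"
    using pair by (simp add: diagonal_pair_def)
  ultimately show ?thesis
    using assms by simp
qed

text \<open>By (3) and (2) for the family \<open>e'\<close>, \<open>f\<close> is the
  \<open>d\<close>-tuple of all \<open>e' s \<circ> f\<close>; applying \<open>e s\<close> and (1)
  for \<open>e\<close> extracts one entry. Taking \<open>e' = e\<close> gives idempotence, and
  distinct families serve to compare two heterogenizations.\<close>

lemma e_e_pair:
  assumes pair': "diagonal_pair \<kappa> S C d e'" and "l \<in> K" "s \<in> U S" "f \<in> ops l"
  shows "un l (e s) (un l (e' s) f) = un l (e s) f"
proof -
  interpret d': diagonal \<kappa> S C d e' by unfold_locales (rule pair')
  have "un l (e s) (un l (e' s) f) = un l (e s) (cmp S l d (\<lambda>s\<in>U S. un l (e' s) f))"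
    by (subst e_d) (use assms in simp_all)
  also have "\<dots> = un l (e s) f"
    using assms by simp
  finally show ?thesis .
qed

lemmas e_idem [simp] = e_e_pair[OF pair]

abbreviation "R \<equiv> retract_clone \<kappa> C e"

lemma R_ops: "f \<in> cl_ops R l v t \<Longrightarrow> f \<in> ops l"
  and R_e: "f \<in> cl_ops R l v t \<Longrightarrow> un l (e t) f = f"
  by (simp_all add: retract_ops_iff)

lemma comp_e_general:
  assumes "l \<in> K" "m \<in> K" "v \<in> sortings \<kappa> S l" "f \<in> ops l" "\<And>i. i \<in> U l \<Longrightarrow> g i \<in> ops m"
  shows "cmp l m (het_restrict \<kappa> C e l v f) (\<lambda>i\<in>U l. g i) = cmp l m f (\<lambda>i\<in>U l. un m (e (v i)) (g i))"
  using assms(1,2,4,5) PiE_mem[OF assms(3)] unfolding het_restrict_def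
  by simp

lemma R_restrict: "f \<in> cl_ops R l v t \<Longrightarrow> het_restrict \<kappa> C e l v f = f"
  by (simp add: retract_clone_def)

text \<open>An operation of \<open>R\<close> equals its own restriction, so it cannot see an
  idempotent of the matching sort put in front of an argument.\<close>

lemma comp_e:
  assumes "f \<in> cl_ops R l v t" "l \<in> K" "m \<in> K" "v \<in> sortings \<kappa> S l" "\<And>i. i \<in> U l \<Longrightarrow> g i \<in> ops m"
  shows "cmp l m f (\<lambda>i\<in>U l. un m (e (v i)) (g i)) = cmp l m f (\<lambda>i\<in>U l. g i)"
  using comp_e_general[of l m v f g] assms R_ops[OF assms(1)] by (simp add: R_restrict)

lemma R_families: "g \<in> families \<kappa> R l v m w \<Longrightarrow> g \<in> U l \<rightarrow>\<^sub>E ops m"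
  by (auto simp: PiE_iff R_ops)

lemma het_restrict_comp:
  assumes "l \<in> K" "m \<in> K" "w \<in> sortings \<kappa> S m" "f \<in> ops l" "g \<in> U l \<rightarrow>\<^sub>E ops m"
  shows "het_restrict \<kappa> C e m w (cmp l m f g) = cmp l m f (\<lambda>i\<in>U l. het_restrict \<kappa> C e m w (g i))"
  using assms(1,2,4,5) PiE_mem[OF assms(3)] unfolding het_restrict_def by simp

text \<open>The two fixed-point conditions are inherited from different factors: the one on the
  inputs from the inner family, the one on the output from the outer operation.\<close>

lemma R_comp_mem:
  assumes "l \<in> K" "m \<in> K" "v \<in> sortings \<kappa> S l" "w \<in> sortings \<kappa> S m" "t \<in> U S"
    "f \<in> cl_ops R l v t" "g \<in> families \<kappa> R l v m w"
  shows "cmp l m f g \<in> cl_ops R m w t"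
proof -
  have g: "g \<in> U l \<rightarrow>\<^sub>E ops m" and f: "f \<in> ops l"
    using assms R_families R_ops by blast+
  have "het_restrict \<kappa> C e m w (cmp l m f g) = cmp l m f (\<lambda>i\<in>U l. het_restrict \<kappa> C e m w (g i))"
    using assms f g by (simp add: het_restrict_comp)
  also have "(\<lambda>i\<in>U l. het_restrict \<kappa> C e m w (g i)) = (\<lambda>i\<in>U l. g i)"
    using PiE_mem[OF assms(7)] by (intro restrict_ext) (rule R_restrict)
  also have "\<dots> = g"
    using g by (rule PiE_restrict)
  finally have "het_restrict \<kappa> C e m w (cmp l m f g) = cmp l m f g" .
  moreover have "un m (e t) (cmp l m f g) = cmp l m (un l (e t) f) g"
    using assms f g by simp
  ultimately show ?thesis
    using assms f g R_e[OF assms(6)] by (simp add: retract_clone_def het_carrier_def)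
qed

lemma R_clone: "is_clone \<kappa> S R"
proof (rule is_cloneI)
  fix l v i assume l: "l \<in> K" and v: "v \<in> sortings \<kappa> S l" and i: "i \<in> U l"
  then show "cl_proj R l v i \<in> cl_ops R l v (v i)"
    using PiE_mem[OF v] by (simp add: retract_ops_iff retract_proj)
next
  fix l1 l2 v1 v2 s f g assume "l1 \<in> K" "l2 \<in> K" "v1 \<in> sortings \<kappa> S l1" "v2 \<in> sortings \<kappa> S l2"
    "s \<in> U S" "f \<in> cl_ops R l1 v1 s" "g \<in> families \<kappa> R l1 v1 l2 v2"
  then show "cl_comp R l1 v1 l2 v2 s f g \<in> cl_ops R l2 v2 s"
    by (simp add: retract_comp R_comp_mem)
next
  fix l1 l2 v1 v2 j g assume *: "l1 \<in> K" "l2 \<in> K" "v1 \<in> sortings \<kappa> S l1" "v2 \<in> sortings \<kappa> S l2"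
    "j \<in> U l1" and g: "g \<in> families \<kappa> R l1 v1 l2 v2"
  then show "cl_comp R l1 v1 l2 v2 (v1 j) (cl_proj R l1 v1 j) g = g j"
    using R_families[OF g] PiE_mem[OF *(3)] R_e[OF PiE_mem[OF g]] by (simp add: retract_comp retract_proj)
qed (simp_all add: retract_comp retract_proj R_families R_ops, simp add: retract_ops_iff)

lemma R_pure: "pure_clone \<kappa> S R"
  unfolding pure_clone_def
proof (intro conjI ballI R_clone)
  fix s t assume "s \<in> U S" "t \<in> U S"
  \<comment> \<open>The identity, cut down by \<open>e s\<close> on its input and then by
    \<open>e t\<close> on its output, is a unary operation between any two given sorts.\<close>
  then have "un one (e t) (un one (e s) (pr one zero)) \<in> cl_ops R one (\<lambda>i\<in>U one. s) t"
    by (simp add: retract_ops_iff)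
  then show "cl_ops R one (\<lambda>i\<in>U one. s) t \<noteq> {}"
    by blast
qed

lemma het_class_eq:
  assumes "f \<in> het_carrier \<kappa> C e l t" "g \<in> het_carrier \<kappa> C e l t"
  shows "het_rel \<kappa> C e l v t `` {f} = het_rel \<kappa> C e l v t `` {g} \<longleftrightarrow>
    het_restrict \<kappa> C e l v f = het_restrict \<kappa> C e l v g"
  using assms by (auto simp: het_rel_def)

lemma R_carrier: "f \<in> cl_ops R l v t \<Longrightarrow> f \<in> het_carrier \<kappa> C e l t"
  by (simp add: retract_clone_def)

text \<open>Idempotence makes a second restriction trivial, and associativity keeps the output fixed
  by \<open>e t\<close>. Restriction is thus the choice of the canonical representative.\<close>

lemma het_restrict_mem:
  assumes "l \<in> K" "v \<in> sortings \<kappa> S l" "t \<in> U S" "f \<in> het_carrier \<kappa> C e l t"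
  shows "het_restrict \<kappa> C e l v f \<in> cl_ops R l v t"
proof -
  have f: "f \<in> ops l" "un l (e t) f = f"
    using assms(4) by (simp_all add: het_carrier_def)
  let ?p = "\<lambda>i\<in>U l. un l (e (v i)) (pr l i)"
  have "un l (e t) (cmp l l f ?p) = cmp l l (un l (e t) f) ?p"
    using assms(1,3) f(1) PiE_mem[OF assms(2)] by simp
  then show ?thesis
    using assms(1,3) f PiE_mem[OF assms(2)]
    by (simp add: retract_ops_iff het_restrict_def)
qed

text \<open>Two operations have the same class exactly if their restrictions agree, and the
  operations of \<open>R\<close> are their own restrictions; so each class contains exactly one of
  them.\<close>

lemma R_iso_het:
  "clone_iso \<kappa> S R (heterogenization \<kappa> C e) (\<lambda>l v t f. het_rel \<kappa> C e l v t `` {f})"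
proof (rule clone_isoI)
  fix l v t assume *: "l \<in> K" "v \<in> sortings \<kappa> S l" "t \<in> U S"
  have "inj_on (\<lambda>f. het_rel \<kappa> C e l v t `` {f}) (cl_ops R l v t)"
    by (rule inj_onI) (simp add: het_class_eq R_carrier R_restrict)
  moreover have "(\<lambda>f. het_rel \<kappa> C e l v t `` {f}) ` cl_ops R l v t = cl_ops (heterogenization \<kappa> C e) l v t"
  proof -
    have "het_rel \<kappa> C e l v t `` {f} \<in> (\<lambda>f. het_rel \<kappa> C e l v t `` {f}) ` cl_ops R l v t"
      if "f \<in> het_carrier \<kappa> C e l t" for f
      using het_class_eq[OF that R_carrier] het_restrict_mem[OF * that]
      by (intro image_eqI[where x = "het_restrict \<kappa> C e l v f"]) (simp_all add: R_restrict)
    moreover have "cl_ops (heterogenization \<kappa> C e) l v t =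
        (\<lambda>f. het_rel \<kappa> C e l v t `` {f}) ` het_carrier \<kappa> C e l t"
      by (auto simp: heterogenization_def quotient_def)
    ultimately show ?thesis
      using R_carrier by auto
  qed
  ultimately show "bij_betw (\<lambda>f. het_rel \<kappa> C e l v t `` {f})
      (cl_ops R l v t) (cl_ops (heterogenization \<kappa> C e) l v t)"
    by (simp add: bij_betw_def)
next
  fix l v i assume "l \<in> K" "v \<in> sortings \<kappa> S l" "i \<in> U l"
  then show "het_rel \<kappa> C e l v (v i) `` {cl_proj R l v i} = cl_proj (heterogenization \<kappa> C e) l v i"
    by (simp add: retract_proj heterogenization_def)
next
  fix l m v w t f g
  assume *: "l \<in> K" "m \<in> K" "v \<in> sortings \<kappa> S l" "w \<in> sortings \<kappa> S m" "t \<in> U S"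
    and f: "f \<in> cl_ops R l v t" and g: "g \<in> families \<kappa> R l v m w"
  let ?cl = "\<lambda>m w t f. het_rel \<kappa> C e m w t `` {f}"
  have self: "h \<in> ?cl n u r h" if "h \<in> cl_ops R n u r" for h n u r
    using R_carrier[OF that] by (simp add: het_rel_def)
  \<comment> \<open>All choices of representatives are compared with the canonical ones by
    restricting their composites.\<close>
  have "?cl m w t (cmp l m f' g') = ?cl m w t (cmp l m f g)"
    if f': "f' \<in> ?cl l v t f" and g': "g' \<in> (\<Pi>\<^sub>E i\<in>U l. ?cl m w (v i) (g i))" for f' g'
  proof -
    have f1: "f' \<in> het_carrier \<kappa> C e l t" "het_restrict \<kappa> C e l v f' = f"
      using f' R_restrict[OF f] by (simp_all add: het_rel_def)
    have g1: "g' i \<in> het_carrier \<kappa> C e m (v i) \<and> het_restrict \<kappa> C e m w (g' i) = g i" if "i \<in> U l" for i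
      using PiE_mem[OF g' that] R_restrict[OF PiE_mem[OF g that]] by (simp add: het_rel_def)
    have f2: "f' \<in> ops l" "un l (e t) f' = f'"
      using f1 by (simp_all add: het_carrier_def)
    have g2: "g' \<in> U l \<rightarrow>\<^sub>E ops m"
      using g' g1 by (auto simp: PiE_iff het_carrier_def)
    have "un m (e t) (cmp l m f' g') = cmp l m (un l (e t) f') g'"
      using * f2(1) g2 by simp
    then have c: "cmp l m f' g' \<in> het_carrier \<kappa> C e m t"
      using * f2 g2 by (simp add: het_carrier_def)
    have "het_restrict \<kappa> C e m w (cmp l m f' g') = cmp l m f' (\<lambda>i\<in>U l. het_restrict \<kappa> C e m w (g' i))"
      using * f2 g2 by (simp add: het_restrict_comp)
    \<comment> \<open>The idempotents act trivially on the canonical \<open>g i\<close>. Written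
      explicitly, they can be absorbed into \<open>f'\<close>, which turns it into its restriction
      \<open>f\<close>.\<close>
    also have "(\<lambda>i\<in>U l. het_restrict \<kappa> C e m w (g' i)) = (\<lambda>i\<in>U l. un m (e (v i)) (g i))"
      using g1 R_e[OF PiE_mem[OF g]] by (intro restrict_ext) simp
    also have "cmp l m f' \<dots> = cmp l m f (\<lambda>i\<in>U l. g i)"
      using comp_e_general[of l m v f' g] * f2 R_ops[OF PiE_mem[OF g]] f1(2) by simp
    also have "\<dots> = cmp l m f g"
      using PiE_restrict[OF g] by simp
    also have "\<dots> = het_restrict \<kappa> C e m w (cmp l m f g)"
      using R_restrict[OF R_comp_mem[OF * f g]] by simp
    finally show ?thesis
      using het_class_eq[OF c R_carrier[OF R_comp_mem[OF * f g]]] by blast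
  qed
  moreover have "g \<in> (\<Pi>\<^sub>E i\<in>U l. ?cl m w (v i) (g i))"
    using g self by (auto simp: PiE_iff)
  moreover have "f \<in> ?cl l v t f"
    using self[OF f] .
  \<comment> \<open>The union is over equal sets, with index sets that are nonempty because they
    contain \<open>f\<close> and \<open>g\<close>.\<close>
  ultimately have "(\<Union>f'\<in>?cl l v t f. \<Union>g'\<in>(\<Pi>\<^sub>E i\<in>U l. ?cl m w (v i) (g i)). ?cl m w t (cmp l m f' g')) =
      ?cl m w t (cmp l m f g)"
    by blast
  then show "?cl m w t (cl_comp R l v m w t f g) =
      cl_comp (heterogenization \<kappa> C e) l v m w t (?cl l v t f) (\<lambda>i\<in>U l. ?cl m w (v i) (g i))"
    by (simp add: heterogenization_def retract_comp)
qed

lemma R_isomorphic_het: "clone_isomorphic \<kappa> S R (heterogenization \<kappa> C e)"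
  unfolding clone_isomorphic_def by (rule exI) (rule R_iso_het)

end

section \<open>Homogenization\<close>

locale sorted_clone = sort_cardinal \<kappa> S for \<kappa> :: "'k rel" and S +
  fixes M :: "('k, 'a) clone"
  assumes many: "is_clone \<kappa> S M"
begin

lemmas many_simps [simp] = clone_proj_mem[OF many] clone_comp_mem[OF many]
  clone_comp_assoc[OF many] clone_proj_comp[OF many] clone_comp_proj[OF many]

abbreviation "H \<equiv> homogenization \<kappa> S M"

lemma H_ops: "ss_ops \<kappa> H l = (\<Pi>\<^sub>E s\<in>U S. cl_ops M (pcard l) (psort l) s)"
  by (simp add: ss_ops_def hom_ops)

lemma H_proj: "ss_proj \<kappa> H l i = (\<lambda>s\<in>U S. cl_proj M (pcard l) (psort l) (pidx l i s))"
  by (simp add: ss_proj_def hom_proj)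

lemma H_comp: "ss_comp \<kappa> H l m f g =
    (\<lambda>s\<in>U S. cl_comp M (pcard l) (psort l) (pcard m) (psort m) s (f s)
       (\<lambda>j\<in>U (pcard l). g (pfst l j) (psnd l j)))"
  by (simp add: ss_comp_def hom_comp)

lemma H_families_mem:
  "g \<in> U l \<rightarrow>\<^sub>E (\<Pi>\<^sub>E s\<in>U S. A s) \<Longrightarrow> i \<in> U l \<Longrightarrow> s \<in> U S \<Longrightarrow> g i s \<in> A s"
  by (blast dest: PiE_mem)

text \<open>Each law is, in every component, the corresponding law of \<open>M\<close> at the
  arities \<open>l \<times> S\<close>; the translations between positions and pairs cancel.\<close>

lemma H_single: "single_sorted \<kappa> H"
proof (rule single_sortedI)
  fix l m f g assume "l \<in> K" "m \<in> K" and f: "f \<in> ss_ops \<kappa> H l" and g: "g \<in> U l \<rightarrow>\<^sub>E ss_ops \<kappa> H m"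
  then show "ss_comp \<kappa> H l m f g \<in> ss_ops \<kappa> H m"
    using PiE_mem[OF f[unfolded H_ops]] H_families_mem[OF g[unfolded H_ops]]
    by (simp add: H_ops H_comp)
next
  fix l m n f g h assume "l \<in> K" "m \<in> K" "n \<in> K" and f: "f \<in> ss_ops \<kappa> H l"
    and g: "g \<in> U l \<rightarrow>\<^sub>E ss_ops \<kappa> H m" and h: "h \<in> U m \<rightarrow>\<^sub>E ss_ops \<kappa> H n"
  then show "ss_comp \<kappa> H m n (ss_comp \<kappa> H l m f g) h =
      ss_comp \<kappa> H l n f (\<lambda>i\<in>U l. ss_comp \<kappa> H m n (g i) h)"
    using PiE_mem[OF f[unfolded H_ops]] H_families_mem[OF g[unfolded H_ops]]
      H_families_mem[OF h[unfolded H_ops]]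
    by (simp add: H_comp)
next
  fix l m i g assume "l \<in> K" "m \<in> K" "i \<in> U l" and g: "g \<in> U l \<rightarrow>\<^sub>E ss_ops \<kappa> H m"
  then show "ss_comp \<kappa> H l m (ss_proj \<kappa> H l i) g = g i"
    using H_families_mem[OF g[unfolded H_ops]] PiE_restrict[OF PiE_mem[OF g[unfolded H_ops]]]
    by (simp add: H_comp H_proj)
next
  fix l f assume "l \<in> K" and f: "f \<in> ss_ops \<kappa> H l"
  then show "ss_comp \<kappa> H l l f (\<lambda>i\<in>U l. ss_proj \<kappa> H l i) = f"
    using PiE_mem[OF f[unfolded H_ops]] PiE_restrict[OF f[unfolded H_ops]]
    by (simp add: H_comp H_proj)
qed (simp add: H_ops H_proj)

lemma hom_iso:
  assumes \<phi>: "clone_iso \<kappa> S M N \<phi>"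
  shows "clone_iso \<kappa> one H (homogenization \<kappa> S N) (\<lambda>l v r f. \<lambda>s\<in>U S. \<phi> (pcard l) (psort l) s (f s))"
proof (rule clone_isoI)
  fix l v r assume l: "l \<in> K"
  show "bij_betw (\<lambda>f. \<lambda>s\<in>U S. \<phi> (pcard l) (psort l) s (f s))
      (cl_ops H l v r) (cl_ops (homogenization \<kappa> S N) l v r)"
  proof (rule bij_betw_byWitness[where f' = "\<lambda>f. \<lambda>s\<in>U S. inv_iso M \<phi> (pcard l) (psort l) s (f s)"];
      (intro ballI image_subsetI)?)
    fix f assume f: "f \<in> cl_ops H l v r"
    show "(\<lambda>s\<in>U S. inv_iso M \<phi> (pcard l) (psort l) s
        ((\<lambda>s\<in>U S. \<phi> (pcard l) (psort l) s (f s)) s)) = f"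
      using PiE_mem[OF f[unfolded hom_ops]] PiE_restrict[OF f[unfolded hom_ops]] l
      by (simp add: inv_iso_left[OF \<phi>])
    show "(\<lambda>s\<in>U S. \<phi> (pcard l) (psort l) s (f s)) \<in> cl_ops (homogenization \<kappa> S N) l v r"
      using PiE_mem[OF f[unfolded hom_ops]] l by (simp add: hom_ops clone_iso_mem[OF \<phi>])
  next
    fix f assume f: "f \<in> cl_ops (homogenization \<kappa> S N) l v r"
    show "(\<lambda>s\<in>U S. \<phi> (pcard l) (psort l) s
        ((\<lambda>s\<in>U S. inv_iso M \<phi> (pcard l) (psort l) s (f s)) s)) = f"
      using PiE_mem[OF f[unfolded hom_ops]] PiE_restrict[OF f[unfolded hom_ops]] l
      by (simp add: inv_iso_right[OF \<phi>])
    show "(\<lambda>s\<in>U S. inv_iso M \<phi> (pcard l) (psort l) s (f s)) \<in> cl_ops H l v r"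
      using PiE_mem[OF f[unfolded hom_ops]] l by (simp add: hom_ops inv_iso_mem[OF \<phi>])
  qed
next
  fix l v i assume "l \<in> K" "i \<in> U l"
  then show "(\<lambda>s\<in>U S. \<phi> (pcard l) (psort l) s (cl_proj H l v i s)) = cl_proj (homogenization \<kappa> S N) l v i"
    by (simp add: hom_proj clone_iso_proj[OF \<phi>])
next
  fix l m v w r f g assume "l \<in> K" "m \<in> K" and v: "v \<in> sortings \<kappa> one l" and "f \<in> cl_ops H l v r"
    and "g \<in> families \<kappa> H l v m w"
  then have *: "l \<in> K" "m \<in> K" and f: "f \<in> ss_ops \<kappa> H l" and g: "g \<in> U l \<rightarrow>\<^sub>E ss_ops \<kappa> H m"
    by (auto simp: hom_ops H_ops)
  show "(\<lambda>s\<in>U S. \<phi> (pcard m) (psort m) s (cl_comp H l v m w r f g s)) =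
      cl_comp (homogenization \<kappa> S N) l v m w r (\<lambda>s\<in>U S. \<phi> (pcard l) (psort l) s (f s))
        (\<lambda>i\<in>U l. \<lambda>s\<in>U S. \<phi> (pcard m) (psort m) s (g i s))"
    using * PiE_mem[OF f[unfolded H_ops]] H_families_mem[OF g[unfolded H_ops]]
    by (simp add: hom_comp clone_iso_comp[OF \<phi>])
qed

lemma hom_isomorphic:
  assumes "clone_isomorphic \<kappa> S M N"
  shows "diagonal_isomorphic \<kappa> S (diag_of_clone \<kappa> S M) (diag_of_clone \<kappa> S N)"
proof -
  obtain \<phi> where \<phi>: "clone_iso \<kappa> S M N \<phi>"
    using assms unfolding clone_isomorphic_def by blast
  \<comment> \<open>The diagonal consists of projections of \<open>M\<close>, which \<phi>
    preserves.\<close>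
  have "(\<lambda>s\<in>U S. \<phi> (pcard S) (psort S) s (homogenization_diag \<kappa> S M s)) = homogenization_diag \<kappa> S N"
    by (simp add: hom_diag clone_iso_proj[OF \<phi>])
  with hom_iso[OF \<phi>] show ?thesis
    unfolding diagonal_isomorphic_def diag_of_clone_def split by blast
qed

end

section \<open>Pure clones and the diagonal pair of their homogenization\<close>

locale pure_sorted_clone = sort_cardinal \<kappa> S for \<kappa> :: "'k rel" and S +
  fixes M :: "('k, 'a) clone"
  assumes pure: "pure_clone \<kappa> S M"

sublocale pure_sorted_clone \<subseteq> sorted_clone
  using pure by unfold_locales (simp add: pure_clone_def)

context pure_sorted_clone
begin

text \<open>These are the unary operations \<open>c\<close> from sort \<open>s\<close> to sort
  \<open>t\<close>, whose existence is purity. Choosing the projection for equal sorts makes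
  \<open>cast\<close> the identity there, on which all later cancellations rest.\<close>

definition conv :: "'k \<Rightarrow> 'k \<Rightarrow> 'a" where
  "conv s t = (if s = t then cl_proj M one (\<lambda>i\<in>U one. s) zero
     else SOME x. x \<in> cl_ops M one (\<lambda>i\<in>U one. s) t)"

definition cast :: "'k \<Rightarrow> ('k \<Rightarrow> 'k) \<Rightarrow> 'k \<Rightarrow> 'k \<Rightarrow> 'a \<Rightarrow> 'a" where
  "cast l v s t x = cl_comp M one (\<lambda>i\<in>U one. s) l v t (conv s t) (\<lambda>i\<in>U one. x)"

lemma conv_mem:
  assumes "s \<in> U S" "t \<in> U S"
  shows "conv s t \<in> cl_ops M one (\<lambda>i\<in>{zero}. s) t"
proof (cases "s = t")
  case True
  then show ?thesis using assms by (simp add: conv_def)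
next
  case False
  have "cl_ops M one (\<lambda>i\<in>U one. s) t \<noteq> {}"
    using pure assms by (simp add: pure_clone_def)
  then show ?thesis
    using False unfolding conv_def by (simp add: some_in_eq)
qed

lemma cast_mem [simp]:
  "l \<in> K \<Longrightarrow> v \<in> sortings \<kappa> S l \<Longrightarrow> s \<in> U S \<Longrightarrow> t \<in> U S \<Longrightarrow> x \<in> cl_ops M l v s \<Longrightarrow>
    cast l v s t x \<in> cl_ops M l v t"
  by (simp add: cast_def conv_mem)

lemma cast_id [simp]:
  "l \<in> K \<Longrightarrow> v \<in> sortings \<kappa> S l \<Longrightarrow> s \<in> U S \<Longrightarrow> x \<in> cl_ops M l v s \<Longrightarrow> cast l v s s x = x"
  by (simp add: cast_def conv_def)

lemma cast_comp [simp]: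
  "l \<in> K \<Longrightarrow> m \<in> K \<Longrightarrow> v \<in> sortings \<kappa> S l \<Longrightarrow> w \<in> sortings \<kappa> S m \<Longrightarrow> s \<in> U S \<Longrightarrow> t \<in> U S \<Longrightarrow>
    x \<in> cl_ops M l v s \<Longrightarrow> h \<in> families \<kappa> M l v m w \<Longrightarrow>
    cl_comp M l v m w t (cast l v s t x) h = cast m w s t (cl_comp M l v m w s x h)"
  by (simp add: cast_def conv_mem)

definition hom_idem :: "'k \<Rightarrow> 'k \<Rightarrow> 'a" where
  "hom_idem s = (\<lambda>t\<in>U S. cast (pcard one) (psort one) s t (cl_proj M (pcard one) (psort one) (pidx one zero s)))"

lemma hom_idem_mem: "s \<in> U S \<Longrightarrow> hom_idem s \<in> ss_ops \<kappa> H one"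
  by (simp add: H_ops hom_idem_def)

text \<open>The result depends only on the component \<open>f s\<close>, and its own component at
  \<open>s\<close> is \<open>f s\<close> again. This accounts for idempotence and for axiom
  (1).\<close>

lemma hom_idem_unary:
  assumes "l \<in> K" "s \<in> U S" and f: "f \<in> ss_ops \<kappa> H l"
  shows "ss_unary \<kappa> H l (hom_idem s) f = (\<lambda>t\<in>U S. cast (pcard l) (psort l) s t (f s))"
  using assms(1,2) PiE_mem[OF f[unfolded H_ops]]
  by (simp add: ss_unary_def H_comp hom_idem_def)

lemma hom_idem_proj:
  assumes "l \<in> K" "s \<in> U S" "i \<in> U l"
  shows "ss_unary \<kappa> H l (hom_idem s) (ss_proj \<kappa> H l i) =
    (\<lambda>t\<in>U S. cast (pcard l) (psort l) s t (cl_proj M (pcard l) (psort l) (pidx l i s)))"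
  using assms by (subst hom_idem_unary) (simp_all add: H_ops H_proj)

text \<open>Component \<open>s\<close> of \<open>d\<close> is the projection at
  \<open>(s, s)\<close>, that is, component \<open>s\<close> of the projection at \<open>s\<close>,
  which gives (1). In (2) only casts between equal sorts remain, and in (3) \<open>d\<close>
  reassembles the projection at 0 from its components.\<close>

lemma hom_diagonal_pair: "diagonal_pair \<kappa> S H (homogenization_diag \<kappa> S M) hom_idem"
proof -
  have d: "homogenization_diag \<kappa> S M \<in> ss_ops \<kappa> H S"
    by (simp add: H_ops hom_diag)
  then show ?thesis
    unfolding diagonal_pair_def
    by (simp add: hom_idem_mem hom_idem_proj hom_idem_unary)
      (simp add: hom_diag H_comp H_proj)
qed

lemma hom_diagonal_clone: "diagonal_clone \<kappa> S (diag_of_clone \<kappa> S M)"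
  unfolding diagonal_clone_def diag_of_clone_def split using H_single hom_diagonal_pair by blast

section \<open>Recovery of \<open>M\<close> from its homogenization\<close>

abbreviation RH where "RH \<equiv> retract_clone \<kappa> H hom_idem"

lemma RH_ops_iff:
  assumes "l \<in> K" "t \<in> U S" and v: "v \<in> sortings \<kappa> S l"
  shows "f \<in> cl_ops RH l v t \<longleftrightarrow> f \<in> (\<Pi>\<^sub>E s\<in>U S. cl_ops M (pcard l) (psort l) s) \<and>
    (\<forall>s\<in>U S. cast (pcard l) (psort l) t s (f t) = f s) \<and>
    (\<forall>s\<in>U S. cl_comp M (pcard l) (psort l) (pcard l) (psort l) s (f s) (\<lambda>j\<in>U (pcard l).
       cast (pcard l) (psort l) (v (pfst l j)) (psnd l j)
         (cl_proj M (pcard l) (psort l) (pidx l (pfst l j) (v (pfst l j))))) = f s)"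
    (is "_ \<longleftrightarrow> ?A \<and> ?B \<and> ?D")
proof (cases ?A)
  case True
  then have f: "f \<in> ss_ops \<kappa> H l" by (simp add: H_ops)
  \<comment> \<open>Both sides have the default value outside \<open>U S\<close>, so the fixed-point
    equations can be tested in each component.\<close>
  have eq: "(\<lambda>s\<in>U S. X s) = f \<longleftrightarrow> (\<forall>s\<in>U S. X s = f s)" for X
    using PiE_arb[OF True] by (auto simp: fun_eq_iff restrict_def)
  show ?thesis
    using assms(1,2) PiE_mem[OF v] f True
    by (simp add: retract_ops_iff hom_idem_unary hom_idem_proj H_comp eq)
qed (simp add: retract_ops_iff H_ops)

definition to_RH where
  "to_RH l v t g = (\<lambda>s\<in>U S. cast (pcard l) (psort l) t s
     (cl_comp M l v (pcard l) (psort l) t g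
       (\<lambda>i\<in>U l. cl_proj M (pcard l) (psort l) (pidx l i (v i)))))"

text \<open>Only component \<open>t\<close> is kept, as it determines the others by casts. The input
  at position \<open>(i, s)\<close> is argument \<open>i\<close>, cast from its sort
  \<open>v i\<close> to \<open>s\<close>.\<close>

definition of_RH where
  "of_RH l v t f = cl_comp M (pcard l) (psort l) l v t (f t)
     (\<lambda>j\<in>U (pcard l). cast l v (v (pfst l j)) (psnd l j) (cl_proj M l v (pfst l j)))"

lemma to_RH_iso: "clone_iso \<kappa> S M RH to_RH"
proof (rule clone_isoI)
  fix l v t assume l: "l \<in> K" and v: "v \<in> sortings \<kappa> S l" and t: "t \<in> U S"
  note * = l v t PiE_mem[OF v]
  show "bij_betw (to_RH l v t) (cl_ops M l v t) (cl_ops RH l v t)"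
  proof (rule bij_betw_byWitness[where f' = "of_RH l v t"]; (intro ballI image_subsetI)?)
    fix g assume g: "g \<in> cl_ops M l v t"
    \<comment> \<open>Only the positions \<open>(i, v i)\<close> and the component \<open>t\<close>
      are read, and there all casts are between equal sorts.\<close>
    then show "of_RH l v t (to_RH l v t g) = g"
      using * by (simp add: of_RH_def to_RH_def)
    show "to_RH l v t g \<in> cl_ops RH l v t"
      using * g by (simp add: RH_ops_iff[OF l t v] to_RH_def)
  next
    fix f assume "f \<in> cl_ops RH l v t"
    then have f: "f \<in> (\<Pi>\<^sub>E s\<in>U S. cl_ops M (pcard l) (psort l) s)"
      and B: "\<And>s. s \<in> U S \<Longrightarrow> cast (pcard l) (psort l) t s (f t) = f s"
      and D: "\<And>s. s \<in> U S \<Longrightarrow> cl_comp M (pcard l) (psort l) (pcard l) (psort l) s (f s) (\<lambda>j\<in>U (pcard l).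
       cast (pcard l) (psort l) (v (pfst l j)) (psnd l j)
         (cl_proj M (pcard l) (psort l) (pidx l (pfst l j) (v (pfst l j))))) = f s"
      by (simp_all add: RH_ops_iff[OF l t v])
    \<comment> \<open>Substitution produces precomposition with the idempotents, which
      \<open>D\<close> absorbs; the casts of component \<open>t\<close> are then the components of
      \<open>f\<close> by \<open>B\<close>.\<close>
    show "to_RH l v t (of_RH l v t f) = f"
      using * PiE_mem[OF f] PiE_restrict[OF f] by (simp add: of_RH_def to_RH_def B D)
    show "of_RH l v t f \<in> cl_ops M l v t"
      using * PiE_mem[OF f] by (simp add: of_RH_def)
  qed
next
  fix l v i assume "l \<in> K" and v: "v \<in> sortings \<kappa> S l" and "i \<in> U l"
  then show "to_RH l v (v i) (cl_proj M l v i) = cl_proj RH l v i"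
    using PiE_mem[OF v] by (simp add: to_RH_def retract_proj hom_idem_proj)
next
  fix l m v w t f g assume "l \<in> K" "m \<in> K" and v: "v \<in> sortings \<kappa> S l" and w: "w \<in> sortings \<kappa> S m"
    and "t \<in> U S" "f \<in> cl_ops M l v t" and g: "g \<in> families \<kappa> M l v m w"
  \<comment> \<open>The image of \<open>f\<close> reads the image of \<open>g i\<close> only in
    component \<open>v i\<close>, where its cast is trivial.\<close>
  then show "to_RH m w t (cl_comp M l v m w t f g) =
      cl_comp RH l v m w t (to_RH l v t f) (\<lambda>i\<in>U l. to_RH m w (v i) (g i))"
    using PiE_mem[OF v] PiE_mem[OF w] PiE_mem[OF g]
    by (simp add: to_RH_def retract_comp H_comp)
qed

end

section \<open>Heterogenization\<close>

lemma diagonal_isomorphic_sym: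
  assumes "diagonal_isomorphic \<kappa> S X Y" "diagonal_clone \<kappa> S X" "sort_cardinal \<kappa> S"
  shows "diagonal_isomorphic \<kappa> S Y X"
proof -
  interpret sort_cardinal \<kappa> S by fact
  obtain C d where X: "X = (C, d)" by (cases X)
  obtain C' d' where Y: "Y = (C', d')" by (cases Y)
  obtain \<phi> where \<phi>: "clone_iso \<kappa> one C C' \<phi>" "\<phi> S (const_sort \<kappa> S) zero d = d'"
    using assms(1) by (auto simp: X Y diagonal_isomorphic_def)
  have C: "single_sorted \<kappa> C" and d: "d \<in> cl_ops C S (const_sort \<kappa> S) zero"
    using assms(2) by (auto simp: X diagonal_clone_def diagonal_pair_def ss_ops_def)
  have "inv_iso C \<phi> S (const_sort \<kappa> S) zero d' = d"
    using inv_iso_left[OF \<phi>(1), of S "const_sort \<kappa> S" zero d] d \<phi>(2) by simp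
  then show ?thesis
    using clone_iso_sym[OF \<phi>(1) C] by (auto simp: X Y diagonal_isomorphic_def)
qed

lemma diagonal_isomorphic_trans:
  assumes "diagonal_isomorphic \<kappa> S X Y" "diagonal_isomorphic \<kappa> S Y Z"
  shows "diagonal_isomorphic \<kappa> S X Z"
proof -
  obtain C d C' d' C'' d'' where XYZ: "X = (C, d)" "Y = (C', d')" "Z = (C'', d'')"
    by (cases X, cases Y, cases Z)
  obtain \<phi> \<psi> where \<phi>: "clone_iso \<kappa> (ord1 \<kappa>) C C' \<phi>" "\<phi> S (const_sort \<kappa> S) (ord0 \<kappa>) d = d'"
    and \<psi>: "clone_iso \<kappa> (ord1 \<kappa>) C' C'' \<psi>" "\<psi> S (const_sort \<kappa> S) (ord0 \<kappa>) d' = d''"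
    using assms by (auto simp: XYZ diagonal_isomorphic_def)
  show ?thesis
    unfolding XYZ diagonal_isomorphic_def split
    using clone_iso_trans[OF \<phi>(1) \<psi>(1)] \<phi>(2) \<psi>(2)
    by (intro exI[of _ "\<lambda>l v s x. \<psi> l v s (\<phi> l v s x)"]) simp
qed

lemma diagonal_isomorphic_refl: "diagonal_clone \<kappa> S X \<Longrightarrow> diagonal_isomorphic \<kappa> S X X"
  unfolding diagonal_isomorphic_def diagonal_clone_def
  by (auto split: prod.splits dest!: clone_iso_refl)

section \<open>Recovery of \<open>(C, d)\<close> as the homogenization of \<open>R\<close>\<close>

context diagonal
begin

text \<open>This packs the \<open>S\<close> inputs at the positions \<open>(i, t)\<close> into one
  value, with \<open>d\<close> as tupling operation.\<close>

definition "ptuple l i = cmp S (pcard l) d (\<lambda>t\<in>U S. pr (pcard l) (pidx l i t))"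

lemma ptuple_mem [simp]: "l \<in> K \<Longrightarrow> i \<in> U l \<Longrightarrow> ptuple l i \<in> ops (pcard l)"
  by (simp add: ptuple_def)

lemma e_ptuple [simp]:
  "l \<in> K \<Longrightarrow> i \<in> U l \<Longrightarrow> s \<in> U S \<Longrightarrow>
    un (pcard l) (e s) (ptuple l i) = un (pcard l) (e s) (pr (pcard l) (pidx l i s))"
  by (simp add: ptuple_def)

lemma ptuple_comp:
  "l \<in> K \<Longrightarrow> m \<in> K \<Longrightarrow> i \<in> U l \<Longrightarrow> h \<in> U (pcard l) \<rightarrow>\<^sub>E ops m \<Longrightarrow>
    cmp (pcard l) m (ptuple l i) h = cmp S m d (\<lambda>t\<in>U S. h (pidx l i t))"
  by (simp add: ptuple_def)

text \<open>Inputs are packed into tuples, \<open>f\<close> is applied, and \<open>e s\<close>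
  extracts an output component.\<close>

definition to_HR where
  "to_HR l f = (\<lambda>s\<in>U S. un (pcard l) (e s) (cmp l (pcard l) f (\<lambda>i\<in>U l. ptuple l i)))"

text \<open>Each argument is copied to all its \<open>S\<close> positions, and \<open>d\<close>
  packs the resulting components.\<close>

definition of_HR where
  "of_HR l f = cmp S l d (\<lambda>s\<in>U S. cmp (pcard l) l (f s) (\<lambda>j\<in>U (pcard l). pr l (pfst l j)))"

lemma to_HR_mem:
  assumes l: "l \<in> K" and f: "f \<in> ops l" and s: "s \<in> U S"
  shows "un (pcard l) (e s) (cmp l (pcard l) f (\<lambda>i\<in>U l. ptuple l i)) \<in> cl_ops R (pcard l) (psort l) s"
proof -
  \<comment> \<open>By axiom (2), a packed tuple does not change when idempotents are applied to its
    entries.\<close>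
  have "cmp (pcard l) (pcard l) (ptuple l i) (\<lambda>j\<in>U (pcard l). un (pcard l) (e (psnd l j)) (pr (pcard l) j)) =
      ptuple l i" if "i \<in> U l" for i
    using l that by (simp add: ptuple_comp) (simp add: ptuple_def)
  then show ?thesis
    using l f s by (simp add: retract_ops_iff)
qed

lemma to_HR_bij:
  assumes l: "l \<in> K"
  shows "bij_betw (to_HR l) (ops l) (\<Pi>\<^sub>E s\<in>U S. cl_ops R (pcard l) (psort l) s)"
proof (rule bij_betw_byWitness[where f' = "of_HR l"]; (intro ballI image_subsetI)?)
  fix f assume f: "f \<in> ops l"
  \<comment> \<open>By axiom (3), packing \<open>S\<close> copies of one projection returns that
    projection.\<close>
  have "cmp (pcard l) l (ptuple l i) (\<lambda>j\<in>U (pcard l). pr l (pfst l j)) = pr l i" if "i \<in> U l" for i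
    using l that by (simp add: ptuple_comp)
  then show "of_HR l (to_HR l f) = f"
    using l f by (simp add: of_HR_def to_HR_def)
  show "to_HR l f \<in> (\<Pi>\<^sub>E s\<in>U S. cl_ops R (pcard l) (psort l) s)"
    using to_HR_mem[OF l f] by (simp add: to_HR_def)
next
  fix f assume f: "f \<in> (\<Pi>\<^sub>E s\<in>U S. cl_ops R (pcard l) (psort l) s)"
  note f_ops = R_ops[OF PiE_mem[OF f]]
  have "un (pcard l) (e s) (cmp l (pcard l) (of_HR l f) (\<lambda>i\<in>U l. ptuple l i)) = f s" if s: "s \<in> U S" for s
  proof -
    \<comment> \<open>An operation of \<open>R\<close> allows idempotents to be put in front of its
      arguments; these unpack the tuples to projections, and the precomposition that remains fixes
      \<open>f s\<close>.\<close>
    have "cmp (pcard l) (pcard l) (f s) (\<lambda>j\<in>U (pcard l). ptuple l (pfst l j)) =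
        cmp (pcard l) (pcard l) (f s) (\<lambda>j\<in>U (pcard l). un (pcard l) (e (psort l j)) (ptuple l (pfst l j)))"
      by (rule comp_e[OF PiE_mem[OF f s], symmetric]) (use l in simp_all)
    also have "\<dots> = cmp (pcard l) (pcard l) (f s) (\<lambda>j\<in>U (pcard l). un (pcard l) (e (psort l j)) (pr (pcard l) j))"
      using l by simp
    also have "\<dots> = f s"
      using PiE_mem[OF f s] unfolding retract_ops_iff by blast
    finally have "cmp (pcard l) (pcard l) (f s) (\<lambda>j\<in>U (pcard l). ptuple l (pfst l j)) = f s" .
    then show ?thesis
      using l s f_ops R_e[OF PiE_mem[OF f s]] by (simp add: of_HR_def)
  qed
  then show "to_HR l (of_HR l f) = f"
    using PiE_restrict[OF f] by (simp add: to_HR_def)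
  show "of_HR l f \<in> ops l"
    using l f_ops by (simp add: of_HR_def)
qed

lemma to_HR_iso: "clone_iso \<kappa> one C (homogenization \<kappa> S R) (\<lambda>l v r. to_HR l)"
proof (rule clone_isoI)
  fix l v r assume "l \<in> K" "v \<in> sortings \<kappa> one l" "r \<in> U one"
  then show "bij_betw (to_HR l) (cl_ops C l v r) (cl_ops (homogenization \<kappa> S R) l v r)"
    using to_HR_bij[of l] by (simp add: hom_ops ss_ops_def)
next
  fix l v i assume "l \<in> K" "v \<in> sortings \<kappa> one l" "i \<in> U l"
  then show "to_HR l (cl_proj C l v i) = cl_proj (homogenization \<kappa> S R) l v i"
    by (simp add: hom_proj to_HR_def retract_proj flip: ss_proj_def[of \<kappa> C])
next
  fix l m v w r f g assume *: "l \<in> K" "m \<in> K" "v \<in> sortings \<kappa> one l" "w \<in> sortings \<kappa> one m" "r \<in> U one"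
    "f \<in> cl_ops C l v r" "g \<in> families \<kappa> C l v m w"
  then have vw: "v = const_sort \<kappa> l" "w = const_sort \<kappa> m" "r = zero"
    and f: "f \<in> ops l" and g: "g \<in> U l \<rightarrow>\<^sub>E ops m"
    by (simp_all add: ss_ops_def)
  \<comment> \<open>On the right, the components extracted from \<open>g i\<close> are packed again
    by the tuple that \<open>f\<close> receives, so (2) and (3) restore \<open>g i\<close>.\<close>
  have "to_HR m (cmp l m f g) = (\<lambda>s\<in>U S. cmp (pcard l) (pcard m) (to_HR l f s)
      (\<lambda>j\<in>U (pcard l). to_HR m (g (pfst l j)) (psnd l j)))"
    using *(1,2) f g PiE_mem[OF g] by (simp add: to_HR_def ptuple_comp)
  then show "to_HR m (cl_comp C l v m w r f g) =
      cl_comp (homogenization \<kappa> S R) l v m w r (to_HR l f) (\<lambda>i\<in>U l. to_HR m (g i))"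
    using * by (simp add: vw hom_comp retract_comp flip: ss_comp_def[of \<kappa> C])
qed

lemma to_HR_isomorphic: "diagonal_isomorphic \<kappa> S (C, d) (diag_of_clone \<kappa> S R)"
proof -
  \<comment> \<open>Extracting entry \<open>s\<close> first from \<open>d\<close> and then from the
    tuple at \<open>s\<close> leaves the projection at \<open>(s, s)\<close> cut down by
    \<open>e s\<close>, a projection of \<open>R\<close>.\<close>
  have "to_HR S d = homogenization_diag \<kappa> S R"
    by (simp add: to_HR_def hom_diag retract_proj)
  then show ?thesis
    using to_HR_iso unfolding diagonal_isomorphic_def diag_of_clone_def by auto
qed

text \<open>Idempotents of the same sort from two families for one \<open>d\<close> absorb each
  other, \<open>e \<circ> e' = e\<close> and \<open>e' \<circ> e = e'\<close>. Cutting down by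
  either family is therefore inverse to cutting down by the other.\<close>

lemma retract_independent:
  assumes pair': "diagonal_pair \<kappa> S C d e'"
  shows "clone_isomorphic \<kappa> S R (retract_clone \<kappa> C e')"
proof -
  interpret d': diagonal \<kappa> S C d e' by unfold_locales (rule pair')
  note ee = e_e_pair[OF pair'] d'.e_e_pair[OF pair]
  \<comment> \<open>The family is a parameter because the same formula gives both the isomorphism
    and its inverse.\<close>
  define \<phi> where "\<phi> e l v t f = un l (e t) (het_restrict \<kappa> C e l v f)" for e :: "'k \<Rightarrow> 'a" and l v t f
  have mem: "\<phi> u l v t f \<in> cl_ops (retract_clone \<kappa> C u) l v t"
    if u: "diagonal_pair \<kappa> S C d u" and "l \<in> K" and v: "v \<in> sortings \<kappa> S l" and "t \<in> U S" "f \<in> ops l" for u l v t f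
  proof -
    interpret u: diagonal \<kappa> S C d u by unfold_locales (rule u)
    show ?thesis
      using that(2,4,5) PiE_mem[OF v] by (simp add: \<phi>_def retract_ops_iff het_restrict_def)
  qed
  have inverse: "\<phi> u l v t (\<phi> u' l v t f) = f"
    if u: "diagonal_pair \<kappa> S C d u" and u': "diagonal_pair \<kappa> S C d u'"
      and l: "l \<in> K" and v: "v \<in> sortings \<kappa> S l" and t: "t \<in> U S"
      and f: "f \<in> cl_ops (retract_clone \<kappa> C u) l v t" for u u' l v t f
  proof -
    interpret u: diagonal \<kappa> S C d u by unfold_locales (rule u)
    interpret u': diagonal \<kappa> S C d u' by unfold_locales (rule u')
    note fo = u.R_ops[OF f] and v' = PiE_mem[OF v]
    have "\<phi> u l v t (\<phi> u' l v t f) =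
        un l (u t) (cmp l l f (\<lambda>i\<in>U l. un l (u' (v i)) (un l (u (v i)) (pr l i))))"
      using l t fo v' by (simp add: \<phi>_def het_restrict_def u.e_e_pair[OF u'])
    \<comment> \<open>\<open>f\<close> tolerates one more \<open>u\<close> in front of its
      arguments, after which \<open>u \<circ> u' \<circ> u\<close> collapses to
      \<open>u\<close>.\<close>
    also have "\<dots> = un l (u t) (cmp l l f (\<lambda>i\<in>U l. un l (u (v i)) (un l (u' (v i)) (un l (u (v i)) (pr l i)))))"
      by (subst u.comp_e[OF f l l v]) (use l v' in simp_all)
    also have "\<dots> = un l (u t) (cmp l l f (\<lambda>i\<in>U l. un l (u (v i)) (pr l i)))"
      using l v' by (simp add: u.e_e_pair[OF u'])
    also have "\<dots> = f"
      using f by (simp add: retract_ops_iff)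
    finally show ?thesis .
  qed
  have "clone_iso \<kappa> S R (retract_clone \<kappa> C e') (\<phi> e')"
  proof (rule clone_isoI)
    fix l v t assume *: "l \<in> K" "v \<in> sortings \<kappa> S l" "t \<in> U S"
    show "bij_betw (\<phi> e' l v t) (cl_ops R l v t) (cl_ops (retract_clone \<kappa> C e') l v t)"
    proof (rule bij_betw_byWitness[where f' = "\<phi> e l v t"]; (intro ballI image_subsetI)?)
      fix f assume f: "f \<in> cl_ops R l v t"
      show "\<phi> e l v t (\<phi> e' l v t f) = f" using inverse[OF pair pair' * f] .
      show "\<phi> e' l v t f \<in> cl_ops (retract_clone \<kappa> C e') l v t" using mem[OF pair' * R_ops[OF f]] .
    next
      fix f assume f: "f \<in> cl_ops (retract_clone \<kappa> C e') l v t"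
      show "\<phi> e' l v t (\<phi> e l v t f) = f" using inverse[OF pair' pair * f] .
      show "\<phi> e l v t f \<in> cl_ops R l v t" using mem[OF pair * d'.R_ops[OF f]] .
    qed
  next
    fix l v i assume "l \<in> K" and v: "v \<in> sortings \<kappa> S l" and "i \<in> U l"
    then show "\<phi> e' l v (v i) (cl_proj R l v i) = cl_proj (retract_clone \<kappa> C e') l v i"
      using PiE_mem[OF v] by (simp add: retract_proj \<phi>_def het_restrict_def ee)
  next
    fix l m v w t f g
    assume *: "l \<in> K" "m \<in> K" "v \<in> sortings \<kappa> S l" "w \<in> sortings \<kappa> S m" "t \<in> U S"
      and f: "f \<in> cl_ops R l v t" and g: "g \<in> families \<kappa> R l v m w"
    note fo = R_ops[OF f] and go = R_ops[OF PiE_mem[OF g]] and v' = PiE_mem[OF *(3)] and w' = PiE_mem[OF *(4)]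
    let ?p = "\<lambda>k\<in>U m. un m (e' (w k)) (pr m k)"
    \<comment> \<open>The idempotents \<open>e'\<close> between \<open>f\<close> and
      \<open>g\<close> disappear: \<open>f\<close> tolerates an \<open>e\<close>, this absorbs
      \<open>e'\<close>, and \<open>f\<close> lets the \<open>e\<close> be dropped again.\<close>
    have "cmp l m f (\<lambda>i\<in>U l. un m (e' (v i)) (cmp m m (g i) ?p)) =
        cmp l m f (\<lambda>i\<in>U l. un m (e (v i)) (un m (e' (v i)) (cmp m m (g i) ?p)))"
      by (rule comp_e[OF f, symmetric]) (use * go v' w' in simp_all)
    also have "\<dots> = cmp l m f (\<lambda>i\<in>U l. un m (e (v i)) (cmp m m (g i) ?p))"
      using * go v' w' by (simp add: ee)
    also have "\<dots> = cmp l m f (\<lambda>i\<in>U l. cmp m m (g i) ?p)"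
      by (rule comp_e[OF f]) (use * go v' w' in simp_all)
    finally have eq: "cmp l m f (\<lambda>i\<in>U l. un m (e' (v i)) (cmp m m (g i) ?p)) =
        cmp l m f (\<lambda>i\<in>U l. cmp m m (g i) ?p)" .
    have "\<phi> e' m w t (cmp l m f g) = un m (e' t) (cmp l m f (\<lambda>i\<in>U l. cmp m m (g i) ?p))"
      using * fo R_families[OF g] w' by (simp add: \<phi>_def het_restrict_def)
    also have "\<dots> = cmp l m (\<phi> e' l v t f) (\<lambda>i\<in>U l. \<phi> e' m w (v i) (g i))"
      using * fo go v' w' by (simp add: \<phi>_def het_restrict_def eq)
    finally show "\<phi> e' m w t (cl_comp R l v m w t f g) =
        cl_comp (retract_clone \<kappa> C e') l v m w t (\<phi> e' l v t f) (\<lambda>i\<in>U l. \<phi> e' m w (v i) (g i))"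
      by (simp add: retract_comp)
  qed
  then show ?thesis
    unfolding clone_isomorphic_def by blast
qed

section \<open>Transport of diagonal pairs and of \<open>R\<close> along an isomorphism\<close>

context
  fixes D :: "('k, 'b) clone" and \<phi>
  assumes \<phi>: "clone_iso \<kappa> one C D \<phi>"
begin

abbreviation "\<psi> l \<equiv> \<phi> l (const_sort \<kappa> l) zero"

lemma single_D: "single_sorted \<kappa> D"
  using clone_iso_is_clone[OF \<phi> single] .

lemma \<psi>_bij: "l \<in> K \<Longrightarrow> bij_betw (\<psi> l) (ops l) (ss_ops \<kappa> D l)"
  using clone_iso_bij[OF \<phi>, of l "const_sort \<kappa> l" zero] by (simp add: ss_ops_def)

lemma \<psi>_mem: "l \<in> K \<Longrightarrow> f \<in> ops l \<Longrightarrow> \<psi> l f \<in> ss_ops \<kappa> D l"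
  using bij_betw_apply[OF \<psi>_bij] .

lemma \<psi>_proj: "l \<in> K \<Longrightarrow> i \<in> U l \<Longrightarrow> \<psi> l (pr l i) = ss_proj \<kappa> D l i"
  using clone_iso_proj[OF \<phi>, of l "const_sort \<kappa> l" i zero] by (simp add: ss_proj_def)

lemma \<psi>_comp:
  "l \<in> K \<Longrightarrow> m \<in> K \<Longrightarrow> f \<in> ops l \<Longrightarrow> g \<in> U l \<rightarrow>\<^sub>E ops m \<Longrightarrow>
    \<psi> m (cmp l m f g) = ss_comp \<kappa> D l m (\<psi> l f) (\<lambda>i\<in>U l. \<psi> m (g i))"
  using clone_iso_comp[OF \<phi>, of l m "const_sort \<kappa> l" "const_sort \<kappa> m" zero f g]
  by (simp add: ss_comp_def ss_ops_def)

lemma \<psi>_unary: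
  "l \<in> K \<Longrightarrow> u \<in> ops one \<Longrightarrow> f \<in> ops l \<Longrightarrow> \<psi> l (un l u f) = ss_unary \<kappa> D l (\<psi> one u) (\<psi> l f)"
  by (simp add: ss_unary_def \<psi>_comp)

lemma diagonal_pair_iso: "diagonal_pair \<kappa> S D (\<psi> S d) (\<lambda>s. \<psi> one (e s))"
proof -
  have "ss_unary \<kappa> D S (\<psi> one (e s)) (\<psi> S d) = ss_unary \<kappa> D S (\<psi> one (e s)) (ss_proj \<kappa> D S s)"
    if "s \<in> U S" for s
  proof -
    have "\<psi> S (un S (e s) d) = \<psi> S (un S (e s) (pr S s))"
      using pair that by (simp add: diagonal_pair_def)
    then show ?thesis
      using that by (simp add: \<psi>_unary \<psi>_proj)
  qed
  moreover have "\<psi> S (cmp S S d (\<lambda>s\<in>U S. un S (e s) (pr S s))) = \<psi> S d"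
    using pair by (simp add: diagonal_pair_def)
  then have "ss_comp \<kappa> D S S (\<psi> S d) (\<lambda>s\<in>U S. ss_unary \<kappa> D S (\<psi> one (e s)) (ss_proj \<kappa> D S s)) = \<psi> S d"
    by (subst (asm) \<psi>_comp) (simp_all add: \<psi>_unary \<psi>_proj)
  moreover have "\<psi> S (cmp S S d (\<lambda>s\<in>U S. pr S zero)) = \<psi> S (pr S zero)"
    using pair by (simp add: diagonal_pair_def)
  then have "ss_comp \<kappa> D S S (\<psi> S d) (\<lambda>s\<in>U S. ss_proj \<kappa> D S zero) = ss_proj \<kappa> D S zero"
    by (subst (asm) \<psi>_comp) (simp_all add: \<psi>_proj)
  ultimately show ?thesis
    unfolding diagonal_pair_def by (simp add: \<psi>_mem)
qed

text \<open>Membership in \<open>R\<close> is given by equations between operations; \<psi>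
  preserves them as a homomorphism and reflects them by injectivity.\<close>

lemma retract_iso: "clone_iso \<kappa> S R (retract_clone \<kappa> D (\<lambda>s. \<psi> one (e s))) (\<lambda>l v t. \<psi> l)"
proof (rule clone_isoI)
  fix l v t assume l: "l \<in> K" and v: "v \<in> sortings \<kappa> S l" and t: "t \<in> U S"
  note v' = PiE_mem[OF v]
  have inj: "inj_on (\<psi> l) (ops l)" and surj: "\<psi> l ` ops l = ss_ops \<kappa> D l"
    using \<psi>_bij[OF l] by (simp_all add: bij_betw_def)
  have iff: "\<psi> l f \<in> cl_ops (retract_clone \<kappa> D (\<lambda>s. \<psi> one (e s))) l v t \<longleftrightarrow> f \<in> cl_ops R l v t"
    if f: "f \<in> ops l" for f
  proof -
    have "ss_unary \<kappa> D l (\<psi> one (e t)) (\<psi> l f) = \<psi> l f \<longleftrightarrow> un l (e t) f = f"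
      using l t f inj_on_eq_iff[OF inj] by (simp flip: \<psi>_unary)
    moreover have "ss_comp \<kappa> D l l (\<psi> l f)
        (\<lambda>i\<in>U l. ss_unary \<kappa> D l (\<psi> one (e (v i))) (ss_proj \<kappa> D l i)) =
        \<psi> l (cmp l l f (\<lambda>i\<in>U l. un l (e (v i)) (pr l i)))"
      using l f v' by (simp add: \<psi>_comp \<psi>_unary \<psi>_proj)
    then have "ss_comp \<kappa> D l l (\<psi> l f)
        (\<lambda>i\<in>U l. ss_unary \<kappa> D l (\<psi> one (e (v i))) (ss_proj \<kappa> D l i)) = \<psi> l f \<longleftrightarrow>
        cmp l l f (\<lambda>i\<in>U l. un l (e (v i)) (pr l i)) = f"
      using l f v' inj_on_eq_iff[OF inj] by simp
    ultimately show ?thesis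
      using l f \<psi>_mem[OF l f] by (simp add: retract_ops_iff)
  qed
  have "\<psi> l ` cl_ops R l v t = cl_ops (retract_clone \<kappa> D (\<lambda>s. \<psi> one (e s))) l v t"
  proof (intro equalityI subsetI)
    fix f assume f: "f \<in> cl_ops (retract_clone \<kappa> D (\<lambda>s. \<psi> one (e s))) l v t"
    then have "f \<in> ss_ops \<kappa> D l" by (simp add: retract_ops_iff)
    then obtain f' where "f' \<in> ops l" "f = \<psi> l f'" using surj by blast
    then show "f \<in> \<psi> l ` cl_ops R l v t" using iff f by blast
  qed (use iff R_ops in blast)
  moreover have "inj_on (\<psi> l) (cl_ops R l v t)"
    using inj by (rule inj_on_subset) (use R_ops in blast)
  ultimately show "bij_betw (\<psi> l) (cl_ops R l v t) (cl_ops (retract_clone \<kappa> D (\<lambda>s. \<psi> one (e s))) l v t)"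
    by (simp add: bij_betw_def)
next
  fix l v i assume "l \<in> K" and v: "v \<in> sortings \<kappa> S l" and "i \<in> U l"
  then show "\<psi> l (cl_proj R l v i) = cl_proj (retract_clone \<kappa> D (\<lambda>s. \<psi> one (e s))) l v i"
    using PiE_mem[OF v] by (simp add: retract_proj \<psi>_unary \<psi>_proj)
next
  fix l m v w t f g assume "l \<in> K" "m \<in> K" "f \<in> cl_ops R l v t" "g \<in> families \<kappa> R l v m w"
  then show "\<psi> m (cl_comp R l v m w t f g) = cl_comp (retract_clone \<kappa> D (\<lambda>s. \<psi> one (e s))) l v m w t
      (\<psi> l f) (\<lambda>i\<in>U l. \<psi> m (g i))"
    by (simp add: retract_comp \<psi>_comp R_ops R_families)
qed

end

text \<open>The isomorphism carries \<open>e\<close> to some family for \<open>c\<close>, possibly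
  different from \<open>u\<close>; independence of the family closes the gap.\<close>

lemma retract_isomorphic:
  assumes "diagonal_isomorphic \<kappa> S (C, d) (D, c)" "diagonal_pair \<kappa> S D c u"
  shows "clone_isomorphic \<kappa> S R (retract_clone \<kappa> D u)"
proof -
  obtain \<phi> where \<phi>: "clone_iso \<kappa> one C D \<phi>" "\<phi> S (const_sort \<kappa> S) zero d = c"
    using assms(1) by (auto simp: diagonal_isomorphic_def)
  interpret D: diagonal \<kappa> S D c "\<lambda>s. \<phi> one (const_sort \<kappa> one) zero (e s)"
    by unfold_locales (use single_D[OF \<phi>(1)] diagonal_pair_iso[OF \<phi>(1)] \<phi>(2) in auto)
  have "clone_isomorphic \<kappa> S R D.R"
    unfolding clone_isomorphic_def by (rule exI) (rule retract_iso[OF \<phi>(1)])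
  then show ?thesis
    using D.retract_independent[OF assms(2)] by (rule clone_isomorphic_trans)
qed

end

section \<open>The correspondence\<close>

lemma pure_clone_isomorphic:
  assumes "clone_isomorphic \<kappa> S M N" "pure_clone \<kappa> S M" and sc: "sort_cardinal \<kappa> S"
  shows "pure_clone \<kappa> S N"
proof -
  interpret sort_cardinal \<kappa> S by fact
  obtain \<phi> where \<phi>: "clone_iso \<kappa> S M N \<phi>"
    using assms(1) unfolding clone_isomorphic_def by blast
  have M: "is_clone \<kappa> S M"
    and ne: "\<And>s t. s \<in> U S \<Longrightarrow> t \<in> U S \<Longrightarrow> cl_ops M one (\<lambda>i\<in>U one. s) t \<noteq> {}"
    using assms(2) unfolding pure_clone_def by blast+
  have "cl_ops N one (\<lambda>i\<in>U one. s) t \<noteq> {}" if "s \<in> U S" "t \<in> U S" for s t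
    using clone_iso_bij[OF \<phi>, of one "\<lambda>i\<in>U one. s" t] ne[OF that] that
    by (auto simp: bij_betw_def)
  then show ?thesis
    using clone_iso_is_clone[OF \<phi> M] unfolding pure_clone_def by blast
qed

text \<open>This moves a clone into another type of operations. As \<open>h\<close> is injective
  only on each set of operations, decoding is done separately in each of them.\<close>

lemma ex_clone_iso_inj:
  fixes M :: "('k, 'a) clone" and h :: "'a \<Rightarrow> 'b"
  assumes M: "is_clone \<kappa> S M" and h: "\<And>l v s. inj_on h (cl_ops M l v s)"
  shows "\<exists>N. clone_iso \<kappa> S M N (\<lambda>_ _ _. h)"
proof
  let ?N = "\<lparr>cl_ops = (\<lambda>l v s. h ` cl_ops M l v s), cl_proj = (\<lambda>l v i. h (cl_proj M l v i)),
    cl_comp = (\<lambda>l1 v1 l2 v2 s f g. h (cl_comp M l1 v1 l2 v2 s (the_inv_into (cl_ops M l1 v1 s) h f)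
      (\<lambda>i\<in>underS \<kappa> l1. the_inv_into (cl_ops M l2 v2 (v1 i)) h (g i))))\<rparr>"
  show "clone_iso \<kappa> S M ?N (\<lambda>_ _ _. h)"
  proof (rule clone_isoI)
    fix l1 l2 v1 v2 s f g assume f: "f \<in> cl_ops M l1 v1 s" and g: "g \<in> families \<kappa> M l1 v1 l2 v2"
    have "(\<lambda>i\<in>underS \<kappa> l1. the_inv_into (cl_ops M l2 v2 (v1 i)) h
        ((\<lambda>i\<in>underS \<kappa> l1. h (g i)) i)) = g"
      using PiE_restrict[OF g] PiE_mem[OF g] by (simp add: the_inv_into_f_f[OF h])
    then show "h (cl_comp M l1 v1 l2 v2 s f g) =
        cl_comp ?N l1 v1 l2 v2 s (h f) (\<lambda>i\<in>underS \<kappa> l1. h (g i))"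
      using f by (simp add: the_inv_into_f_f[OF h] del: restrict_apply)
  qed (use h in \<open>simp_all add: bij_betw_def\<close>)
qed

text \<open>A relation that is total on both sides and compatible with both equivalences matches
  their classes: whenever \<open>P x y\<close> holds, \<open>F\<close> sends the class of
  \<open>x\<close> to that of \<open>y\<close>, and \<open>G\<close> sends it back.\<close>

lemma quotient_correspondence:
  assumes r: "equiv A r" and s: "equiv B s"
    and left: "\<And>x. x \<in> A \<Longrightarrow> \<exists>y\<in>B. P x y" and right: "\<And>y. y \<in> B \<Longrightarrow> \<exists>x\<in>A. P x y"
    and compat: "\<And>x x' y y'. x \<in> A \<Longrightarrow> x' \<in> A \<Longrightarrow> y \<in> B \<Longrightarrow> y' \<in> B \<Longrightarrow> P x y \<Longrightarrow> P x' y' \<Longrightarrow>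
      (x, x') \<in> r \<longleftrightarrow> (y, y') \<in> s"
    and F: "\<And>X. X \<subseteq> A \<Longrightarrow> F X = {y \<in> B. \<exists>x\<in>X. P x y}"
    and G: "\<And>Y. Y \<subseteq> B \<Longrightarrow> G Y = {x \<in> A. \<exists>y\<in>Y. P x y}"
  shows "bij_betw F (A // r) (B // s)" "bij_betw G (B // s) (A // r)"
    "\<forall>X\<in>A // r. G (F X) = X" "\<forall>Y\<in>B // s. F (G Y) = Y"
proof -
  have sub: "r `` {x} \<subseteq> A" "s `` {y} \<subseteq> B" for x y
    using r s by (auto simp: equiv_def refl_on_def)
  have FX: "F (r `` {x}) = s `` {y}" and GY: "G (s `` {y}) = r `` {x}"
    if "x \<in> A" "y \<in> B" "P x y" for x y
  proof -
    show "F (r `` {x}) = s `` {y}"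
      unfolding F[OF sub(1)] using that right compat sub by blast
    show "G (s `` {y}) = r `` {x}"
      unfolding G[OF sub(2)] using that left compat sub by blast
  qed
  have X: "F X \<in> B // s \<and> G (F X) = X" if "X \<in> A // r" for X
  proof -
    obtain x where x: "x \<in> A" "X = r `` {x}" using \<open>X \<in> A // r\<close> by (rule quotientE)
    moreover obtain y where "y \<in> B" "P x y" using left[OF x(1)] by blast
    ultimately show ?thesis by (simp add: FX GY quotientI)
  qed
  have Y: "G Y \<in> A // r \<and> F (G Y) = Y" if "Y \<in> B // s" for Y
  proof -
    obtain y where y: "y \<in> B" "Y = s `` {y}" using \<open>Y \<in> B // s\<close> by (rule quotientE)
    moreover obtain x where "x \<in> A" "P x y" using right[OF y(1)] by blast
    ultimately show ?thesis by (simp add: FX GY quotientI)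
  qed
  show "\<forall>X\<in>A // r. G (F X) = X" "\<forall>Y\<in>B // s. F (G Y) = Y"
    using X Y by blast+
  show "bij_betw F (A // r) (B // s)" by (rule bij_betw_byWitness[where f' = G]) (use X Y in blast)+
  show "bij_betw G (B // s) (A // r)" by (rule bij_betw_byWitness[where f' = F]) (use X Y in blast)+
qed

section \<open>The two assignments on isomorphism classes\<close>

context sort_cardinal
begin

lemma is_clone_pure: "pure_clone \<kappa> S M \<Longrightarrow> is_clone \<kappa> S M"
  by (simp add: pure_clone_def)

lemma diagonal_locale:
  assumes "diagonal_clone \<kappa> S (C, d)" "diagonal_pair \<kappa> S C d e"
  shows "diagonal \<kappa> S C d e"
  using assms by unfold_locales (simp_all add: diagonal_clone_def)

text \<open>\<open>clone_of_diag\<close> fixes some family by \<open>SOME\<close>, while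
  \<open>e\<close> is arbitrary; the retracts for the two families are isomorphic.\<close>

lemma retract_clone_of_diag:
  assumes X: "diagonal_clone \<kappa> S (C, d)" and e: "diagonal_pair \<kappa> S C d e"
  shows "clone_isomorphic \<kappa> S (retract_clone \<kappa> C e) (clone_of_diag \<kappa> S (C, d))"
proof -
  interpret diagonal \<kappa> S C d e using diagonal_locale[OF X e] .
  have e': "diagonal_pair \<kappa> S C d (SOME e. diagonal_pair \<kappa> S C d e)"
    using e someI[of "diagonal_pair \<kappa> S C d" e] by simp
  interpret e': diagonal \<kappa> S C d "SOME e. diagonal_pair \<kappa> S C d e"
    using diagonal_locale[OF X e'] .
  show ?thesis
    unfolding clone_of_diag_def split
    using retract_independent[OF e'] e'.R_isomorphic_het by (rule clone_isomorphic_trans)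
qed

lemma diagonal_cloneE:
  assumes "diagonal_clone \<kappa> S X"
  obtains C d e where "X = (C, d)" "diagonal_clone \<kappa> S (C, d)" "diagonal_pair \<kappa> S C d e"
    "diagonal \<kappa> S C d e"
proof -
  obtain C d where X: "X = (C, d)" by (cases X)
  have C: "diagonal_clone \<kappa> S (C, d)"
    using assms by (simp add: X)
  then obtain e where e: "diagonal_pair \<kappa> S C d e"
    by (auto simp: diagonal_clone_def)
  show ?thesis
    using that[OF X C e diagonal_locale[OF C e]] .
qed

lemma heterogenization_pure:
  assumes X: "diagonal_clone \<kappa> S (C, d)" and e: "diagonal_pair \<kappa> S C d e"
  shows "pure_clone \<kappa> S (heterogenization \<kappa> C e)"
    and "clone_isomorphic \<kappa> S (heterogenization \<kappa> C e) (clone_of_diag \<kappa> S (C, d))"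
proof -
  interpret diagonal \<kappa> S C d e using diagonal_locale[OF X e] .
  show "pure_clone \<kappa> S (heterogenization \<kappa> C e)"
    using pure_clone_isomorphic[OF R_isomorphic_het R_pure sort_cardinal_axioms] .
  show "clone_isomorphic \<kappa> S (heterogenization \<kappa> C e) (clone_of_diag \<kappa> S (C, d))"
    using clone_isomorphic_sym[OF R_isomorphic_het R_clone] retract_clone_of_diag[OF X e]
    by (rule clone_isomorphic_trans)
qed

lemma clone_of_diag_pure:
  assumes "diagonal_clone \<kappa> S X"
  shows "pure_clone \<kappa> S (clone_of_diag \<kappa> S X)"
  using assms pure_clone_isomorphic[OF _ _ sort_cardinal_axioms] heterogenization_pure
  by (metis diagonal_cloneE)

lemma diag_of_clone_diagonal:
  "pure_clone \<kappa> S M \<Longrightarrow> diagonal_clone \<kappa> S (diag_of_clone \<kappa> S M)"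
  by (rule pure_sorted_clone.hom_diagonal_clone) unfold_locales

lemma diag_of_clone_isomorphic:
  assumes "is_clone \<kappa> S M" "clone_isomorphic \<kappa> S M N"
  shows "diagonal_isomorphic \<kappa> S (diag_of_clone \<kappa> S M) (diag_of_clone \<kappa> S N)"
  by (rule sorted_clone.hom_isomorphic[OF _ assms(2)]) (unfold_locales, rule assms(1))

lemma clone_of_diag_isomorphic:
  assumes "diagonal_clone \<kappa> S X" "diagonal_clone \<kappa> S Y" "diagonal_isomorphic \<kappa> S X Y"
  shows "clone_isomorphic \<kappa> S (clone_of_diag \<kappa> S X) (clone_of_diag \<kappa> S Y)"
proof -
  obtain C d e where X: "X = (C, d)" "diagonal_clone \<kappa> S (C, d)" "diagonal_pair \<kappa> S C d e"
    and C: "diagonal \<kappa> S C d e" using assms(1) by (rule diagonal_cloneE)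
  obtain D c u where Y: "Y = (D, c)" "diagonal_clone \<kappa> S (D, c)" "diagonal_pair \<kappa> S D c u"
    using assms(2) by (rule diagonal_cloneE)
  interpret diagonal \<kappa> S C d e by (rule C)
  have "clone_isomorphic \<kappa> S (clone_of_diag \<kappa> S X) R"
    using clone_isomorphic_sym[OF retract_clone_of_diag[OF X(2,3)] R_clone] X(1) by simp
  moreover have "clone_isomorphic \<kappa> S R (retract_clone \<kappa> D u)"
    using retract_isomorphic[OF _ Y(3)] assms(3) X(1) Y(1) by simp
  moreover have "clone_isomorphic \<kappa> S (retract_clone \<kappa> D u) (clone_of_diag \<kappa> S Y)"
    using retract_clone_of_diag[OF Y(2,3)] Y(1) by simp
  ultimately show ?thesis
    by (blast intro: clone_isomorphic_trans)
qed

lemma diag_of_clone_of_diag: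
  assumes "diagonal_clone \<kappa> S X"
  shows "diagonal_isomorphic \<kappa> S (diag_of_clone \<kappa> S (clone_of_diag \<kappa> S X)) X"
proof -
  obtain C d e where X: "X = (C, d)" "diagonal_clone \<kappa> S (C, d)" "diagonal_pair \<kappa> S C d e"
    and C: "diagonal \<kappa> S C d e" using assms by (rule diagonal_cloneE)
  interpret diagonal \<kappa> S C d e by (rule C)
  have "diagonal_isomorphic \<kappa> S X (diag_of_clone \<kappa> S (clone_of_diag \<kappa> S X))"
    using diagonal_isomorphic_trans[OF to_HR_isomorphic
        diag_of_clone_isomorphic[OF R_clone retract_clone_of_diag[OF X(2,3)]]] X(1) by simp
  then show ?thesis
    using assms sort_cardinal_axioms by (rule diagonal_isomorphic_sym)
qed

lemma clone_of_diag_of_clone: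
  assumes "pure_clone \<kappa> S M"
  shows "clone_isomorphic \<kappa> S (clone_of_diag \<kappa> S (diag_of_clone \<kappa> S M)) M"
proof -
  interpret pure_sorted_clone \<kappa> S M by unfold_locales (rule assms)
  have "clone_isomorphic \<kappa> S M (retract_clone \<kappa> H hom_idem)"
    unfolding clone_isomorphic_def by (rule exI) (rule to_RH_iso)
  moreover have "clone_isomorphic \<kappa> S (retract_clone \<kappa> H hom_idem)
      (clone_of_diag \<kappa> S (diag_of_clone \<kappa> S M))"
    using retract_clone_of_diag[OF _ hom_diagonal_pair] hom_diagonal_clone
    unfolding diag_of_clone_def by blast
  ultimately show ?thesis
    using clone_isomorphic_sym[OF clone_isomorphic_trans many] by blast
qed

lemma diagonal_clone_isomorphic:
  assumes "diagonal_clone \<kappa> S X" "diagonal_isomorphic \<kappa> S X Y"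
  shows "diagonal_clone \<kappa> S Y"
proof -
  obtain C d e where X: "X = (C, d)" and C: "diagonal \<kappa> S C d e"
    using assms(1) by (rule diagonal_cloneE)
  interpret diagonal \<kappa> S C d e by (rule C)
  obtain D c where Y: "Y = (D, c)" by (cases Y)
  obtain \<phi> where \<phi>: "clone_iso \<kappa> one C D \<phi>" "\<phi> S (const_sort \<kappa> S) zero d = c"
    using assms(2) by (auto simp: X Y diagonal_isomorphic_def)
  show ?thesis
    using single_D[OF \<phi>(1)] diagonal_pair_iso[OF \<phi>(1)] \<phi>(2)
    by (auto simp: Y diagonal_clone_def)
qed

text \<open>For the converse direction, homogenization is applied to the isomorphism, and both sides
  are recovered from their heterogenizations.\<close>

lemma clone_of_diag_iff:
  assumes X: "diagonal_clone \<kappa> S X" and Y: "diagonal_clone \<kappa> S Y"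
  shows "diagonal_isomorphic \<kappa> S X Y \<longleftrightarrow>
    clone_isomorphic \<kappa> S (clone_of_diag \<kappa> S X) (clone_of_diag \<kappa> S Y)"
proof
  assume "clone_isomorphic \<kappa> S (clone_of_diag \<kappa> S X) (clone_of_diag \<kappa> S Y)"
  then have "diagonal_isomorphic \<kappa> S (diag_of_clone \<kappa> S (clone_of_diag \<kappa> S X))
      (diag_of_clone \<kappa> S (clone_of_diag \<kappa> S Y))"
    by (rule diag_of_clone_isomorphic[OF is_clone_pure[OF clone_of_diag_pure[OF X]]])
  moreover have "diagonal_isomorphic \<kappa> S X (diag_of_clone \<kappa> S (clone_of_diag \<kappa> S X))"
    using diag_of_clone_of_diag[OF X] diag_of_clone_diagonal[OF clone_of_diag_pure[OF X]]
      sort_cardinal_axioms by (rule diagonal_isomorphic_sym)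
  ultimately show "diagonal_isomorphic \<kappa> S X Y"
    using diag_of_clone_of_diag[OF Y] by (blast intro: diagonal_isomorphic_trans)
qed (rule clone_of_diag_isomorphic[OF X Y])

text \<open>Thanks to this, one and the same relation between clones describes both induced maps on
  classes.\<close>

lemma diag_of_clone_iff_clone_of_diag:
  assumes M: "pure_clone \<kappa> S M" and X: "diagonal_clone \<kappa> S X"
  shows "diagonal_isomorphic \<kappa> S (diag_of_clone \<kappa> S M) X \<longleftrightarrow>
    clone_isomorphic \<kappa> S (clone_of_diag \<kappa> S X) M"
proof
  assume iso: "diagonal_isomorphic \<kappa> S (diag_of_clone \<kappa> S M) X"
  have "clone_isomorphic \<kappa> S (clone_of_diag \<kappa> S X) (clone_of_diag \<kappa> S (diag_of_clone \<kappa> S M))"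
    using clone_of_diag_isomorphic[OF X _ diagonal_isomorphic_sym[OF iso _ sort_cardinal_axioms]]
      diag_of_clone_diagonal[OF M] by blast
  then show "clone_isomorphic \<kappa> S (clone_of_diag \<kappa> S X) M"
    using clone_of_diag_of_clone[OF M] by (rule clone_isomorphic_trans)
next
  assume "clone_isomorphic \<kappa> S (clone_of_diag \<kappa> S X) M"
  then have "clone_isomorphic \<kappa> S M (clone_of_diag \<kappa> S X)"
    using is_clone_pure[OF clone_of_diag_pure[OF X]] by (rule clone_isomorphic_sym)
  then show "diagonal_isomorphic \<kappa> S (diag_of_clone \<kappa> S M) X"
    using diagonal_isomorphic_trans[OF diag_of_clone_isomorphic[OF is_clone_pure[OF M]]
        diag_of_clone_of_diag[OF X]] by blast
qed

lemma diag_of_clone_iff: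
  assumes M: "pure_clone \<kappa> S M" and N: "pure_clone \<kappa> S N"
  shows "clone_isomorphic \<kappa> S M N \<longleftrightarrow>
    diagonal_isomorphic \<kappa> S (diag_of_clone \<kappa> S M) (diag_of_clone \<kappa> S N)"
proof
  assume "diagonal_isomorphic \<kappa> S (diag_of_clone \<kappa> S M) (diag_of_clone \<kappa> S N)"
  then have "clone_isomorphic \<kappa> S (clone_of_diag \<kappa> S (diag_of_clone \<kappa> S N)) M"
    using diag_of_clone_iff_clone_of_diag[OF M diag_of_clone_diagonal[OF N]] by blast
  then have "clone_isomorphic \<kappa> S M (clone_of_diag \<kappa> S (diag_of_clone \<kappa> S N))"
    using is_clone_pure[OF clone_of_diag_pure[OF diag_of_clone_diagonal[OF N]]]
    by (rule clone_isomorphic_sym)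
  then show "clone_isomorphic \<kappa> S M N"
    using clone_of_diag_of_clone[OF N] by (rule clone_isomorphic_trans)
qed (rule diag_of_clone_isomorphic[OF is_clone_pure[OF M]])

text \<open>The relation is that heterogenizing \<open>X\<close> gives a clone isomorphic to
  \<open>M\<close>. The operations of \<open>H(M)\<close> are \<open>S\<close>-indexed families over
  \<open>'u\<close>, and \<open>h\<close> encodes these in \<open>'u\<close> again.\<close>

lemma class_correspondence:
  fixes h :: "('k \<Rightarrow> 'u) \<Rightarrow> 'u"
  assumes h: "inj_on h (U S \<rightarrow>\<^sub>E UNIV)"
  defines "\<D> \<equiv> diagonal_classes \<kappa> S :: (('k, 'u) clone \<times> 'u) set set"
    and "\<P> \<equiv> pure_classes \<kappa> S :: ('k, 'u) clone set set"
  shows "bij_betw (het_class \<kappa> S) \<D> \<P>" "bij_betw (hom_class \<kappa> S) \<P> \<D>"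
    "\<forall>\<X>\<in>\<D>. hom_class \<kappa> S (het_class \<kappa> S \<X>) = \<X>" "\<forall>\<M>\<in>\<P>. het_class \<kappa> S (hom_class \<kappa> S \<M>) = \<M>"
proof -
  let ?A = "{X :: ('k, 'u) clone \<times> 'u. diagonal_clone \<kappa> S X}"
  let ?r = "{(X :: ('k, 'u) clone \<times> 'u, Y :: ('k, 'u) clone \<times> 'u).
    diagonal_clone \<kappa> S X \<and> diagonal_clone \<kappa> S Y \<and> diagonal_isomorphic \<kappa> S X Y}"
  let ?B = "{M :: ('k, 'u) clone. pure_clone \<kappa> S M}"
  let ?s = "{(M :: ('k, 'u) clone, N :: ('k, 'u) clone).
    pure_clone \<kappa> S M \<and> pure_clone \<kappa> S N \<and> clone_isomorphic \<kappa> S M N}"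
  let ?P = "\<lambda>X M. clone_isomorphic \<kappa> S (clone_of_diag \<kappa> S X) M"
  have r: "equiv ?A ?r"
    by (rule equivI)
      (auto simp: refl_on_def intro!: symI transI intro: diagonal_isomorphic_refl
        diagonal_isomorphic_sym[OF _ _ sort_cardinal_axioms] diagonal_isomorphic_trans)
  have s: "equiv ?B ?s"
    by (rule equivI)
      (auto simp: refl_on_def intro!: symI transI intro: clone_isomorphic_refl is_clone_pure
        clone_isomorphic_sym clone_isomorphic_trans)
  have left: "\<exists>M\<in>?B. ?P X M" if "X \<in> ?A" for X
  proof -
    from that obtain C d e where X: "X = (C, d)" "diagonal_clone \<kappa> S (C, d)" "diagonal_pair \<kappa> S C d e"
      and C: "diagonal \<kappa> S C d e" by (auto elim: diagonal_cloneE)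
    interpret diagonal \<kappa> S C d e by (rule C)
    \<comment> \<open>The heterogenization consists of sets of operations, but \<open>R\<close> is
      isomorphic to it and stays within the type of \<open>C\<close>.\<close>
    have "?P X R"
      using clone_isomorphic_sym[OF retract_clone_of_diag[OF X(2,3)] R_clone] X(1) by simp
    then show ?thesis using R_pure by blast
  qed
  have right: "\<exists>X\<in>?A. ?P X M" if "M \<in> ?B" for M
  proof -
    have M: "pure_clone \<kappa> S M" using that by simp
    interpret pure_sorted_clone \<kappa> S M by unfold_locales (rule M)
    have "inj_on h (cl_ops H l v t)" for l v t
      using h by (rule inj_on_subset) (auto simp: hom_ops PiE_iff)
    then obtain C where "clone_iso \<kappa> one H C (\<lambda>_ _ _. h)"
      using ex_clone_iso_inj[OF H_single] by blast
    then have iso: "diagonal_isomorphic \<kappa> S (diag_of_clone \<kappa> S M) (C, h (homogenization_diag \<kappa> S M))"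
      unfolding diagonal_isomorphic_def diag_of_clone_def by auto
    then show ?thesis
      using diagonal_clone_isomorphic[OF hom_diagonal_clone iso]
        diag_of_clone_iff_clone_of_diag[OF M] by blast
  qed
  have compat: "(X, X') \<in> ?r \<longleftrightarrow> (M, M') \<in> ?s"
    if "X \<in> ?A" "X' \<in> ?A" "M \<in> ?B" "M' \<in> ?B" "?P X M" "?P X' M'" for X X' M M'
  proof -
    have X: "is_clone \<kappa> S (clone_of_diag \<kappa> S X)" "is_clone \<kappa> S (clone_of_diag \<kappa> S X')"
      using that clone_of_diag_pure is_clone_pure by blast+
    have sym: "clone_isomorphic \<kappa> S M (clone_of_diag \<kappa> S X)"
      "clone_isomorphic \<kappa> S M' (clone_of_diag \<kappa> S X')"
      by (rule clone_isomorphic_sym[OF that(5) X(1)], rule clone_isomorphic_sym[OF that(6) X(2)])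
    have "clone_isomorphic \<kappa> S (clone_of_diag \<kappa> S X) (clone_of_diag \<kappa> S X') \<longleftrightarrow> clone_isomorphic \<kappa> S M M'"
      using clone_isomorphic_trans[OF clone_isomorphic_trans[OF sym(1)] that(6)]
        clone_isomorphic_trans[OF clone_isomorphic_trans[OF that(5)] sym(2)] by blast
    then show ?thesis
      using that clone_of_diag_iff[of X X'] by simp
  qed
  have F: "het_class \<kappa> S \<X> = {M \<in> ?B. \<exists>X\<in>\<X>. ?P X M}" for \<X>
    by (simp add: het_class_def)
  \<comment> \<open>The homogenization condition is rewritten into the relation \<open>?P\<close>,
    which is legitimate for pure clones.\<close>
  have G: "hom_class \<kappa> S \<M> = {X \<in> ?A. \<exists>M\<in>\<M>. ?P X M}" if "\<M> \<subseteq> ?B" for \<M>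
    using that diag_of_clone_iff_clone_of_diag unfolding hom_class_def by blast
  note * = quotient_correspondence[where P = ?P and F = "het_class \<kappa> S" and G = "hom_class \<kappa> S", OF r s left right compat F G]
  show "bij_betw (het_class \<kappa> S) \<D> \<P>"
    unfolding \<D>_def \<P>_def diagonal_classes_def pure_classes_def by (rule *(1))
  show "bij_betw (hom_class \<kappa> S) \<P> \<D>"
    unfolding \<D>_def \<P>_def diagonal_classes_def pure_classes_def by (rule *(2))
  show "\<forall>\<X>\<in>\<D>. hom_class \<kappa> S (het_class \<kappa> S \<X>) = \<X>"
    unfolding \<D>_def \<P>_def diagonal_classes_def pure_classes_def by (rule *(3))
  show "\<forall>\<M>\<in>\<P>. het_class \<kappa> S (hom_class \<kappa> S \<M>) = \<M>"
    unfolding \<D>_def \<P>_def diagonal_classes_def pure_classes_def by (rule *(4))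
qed

end

theorem theorem6p5:
  fixes \<kappa> :: "'k rel" and S :: 'k
  assumes "Card_order \<kappa>" and "infinite (Field \<kappa>)"
    and "S \<in> cardinals \<kappa>" and "S \<noteq> ord0 \<kappa>"
  shows
    \<comment> \<open>\<open>C\<^sub>d\<close> is a pure clone, independent of the choice of \<open>(e\<^sub>s)\<close> up to isomorphism\<close>
    "(\<forall>(C :: ('k, 'a) clone) d. diagonal_clone \<kappa> S (C, d) \<longrightarrow>
        pure_clone \<kappa> S (clone_of_diag \<kappa> S (C, d)) \<and>
        (\<forall>e. diagonal_pair \<kappa> S C d e \<longrightarrow>
           pure_clone \<kappa> S (heterogenization \<kappa> C e) \<and>
           clone_isomorphic \<kappa> S (heterogenization \<kappa> C e) (clone_of_diag \<kappa> S (C, d)))) \<and>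
     (\<forall>M :: ('k, 'c) clone. pure_clone \<kappa> S M \<longrightarrow> diagonal_clone \<kappa> S (diag_of_clone \<kappa> S M)) \<and>
     \<comment> \<open>both assignments are well defined and injective on isomorphism classes\<close>
     (\<forall>(X :: ('k, 'a) clone \<times> 'a) (Y :: ('k, 'b) clone \<times> 'b).
        diagonal_clone \<kappa> S X \<longrightarrow> diagonal_clone \<kappa> S Y \<longrightarrow>
        (diagonal_isomorphic \<kappa> S X Y \<longleftrightarrow>
         clone_isomorphic \<kappa> S (clone_of_diag \<kappa> S X) (clone_of_diag \<kappa> S Y))) \<and>
     (\<forall>(M :: ('k, 'c) clone) (N :: ('k, 'd) clone).
        pure_clone \<kappa> S M \<longrightarrow> pure_clone \<kappa> S N \<longrightarrow>
        (clone_isomorphic \<kappa> S M N \<longleftrightarrow>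
         diagonal_isomorphic \<kappa> S (diag_of_clone \<kappa> S M) (diag_of_clone \<kappa> S N))) \<and>
     \<comment> \<open>they are mutually inverse up to isomorphism\<close>
     (\<forall>X :: ('k, 'a) clone \<times> 'a. diagonal_clone \<kappa> S X \<longrightarrow>
        diagonal_isomorphic \<kappa> S (diag_of_clone \<kappa> S (clone_of_diag \<kappa> S X)) X) \<and>
     (\<forall>M :: ('k, 'c) clone. pure_clone \<kappa> S M \<longrightarrow>
        clone_isomorphic \<kappa> S (clone_of_diag \<kappa> S (diag_of_clone \<kappa> S M)) M) \<and>
     \<comment> \<open>within any type \<open>'u\<close> closed under \<open>S\<close>-fold products they induce mutually inverse bijections
        between the sets of isomorphism classes\<close>
     ((\<exists>h :: ('k \<Rightarrow> 'u) \<Rightarrow> 'u. inj_on h (underS \<kappa> S \<rightarrow>\<^sub>E UNIV)) \<longrightarrow>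
        bij_betw (het_class \<kappa> S)
          (diagonal_classes \<kappa> S :: (('k, 'u) clone \<times> 'u) set set) (pure_classes \<kappa> S) \<and>
        bij_betw (hom_class \<kappa> S)
          (pure_classes \<kappa> S) (diagonal_classes \<kappa> S :: (('k, 'u) clone \<times> 'u) set set) \<and>
        (\<forall>\<X> \<in> (diagonal_classes \<kappa> S :: (('k, 'u) clone \<times> 'u) set set).
           hom_class \<kappa> S (het_class \<kappa> S \<X>) = \<X>) \<and>
        (\<forall>\<M> \<in> (pure_classes \<kappa> S :: ('k, 'u) clone set set).
           het_class \<kappa> S (hom_class \<kappa> S \<M>) = \<M>))"
proof -
  interpret sort_cardinal \<kappa> S using assms by unfold_locales
  show ?thesis
    by (intro conjI allI impI; (elim exE)?)
      (assumption | rule clone_of_diag_pure heterogenization_pure diag_of_clone_diagonal clone_of_diag_iff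
        diag_of_clone_iff diag_of_clone_of_diag clone_of_diag_of_clone class_correspondence)+
qed

end
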